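(* Let $n\ge 2$, $m\in\{1,\dots,n-1\}$, let $\lambda_1<\lambda_2$ be real numbers, and let $A\in C([0,1]\times[\lambda_1,\lambda_2],\mathbb{R}^{n\times n})$ (Assumption (A)), with entries $a_{ij}(x;\lambda)$. Let $\mathsf{p}\subset\mathbb{R}^n$ be a subspace of dimension $m$ and $\mathsf{q}\subset\mathbb{R}^n$ a subspace of dimension $n-m$, and consider the eigenvalue problem $$\frac{dy}{dx}=A(x;\lambda)y,\quad x\in(0,1),\qquad y(0)\in\mathsf{p},\quad y(1)\in\mathsf{q}.$$ Let $\mathsf{g}(x;\lambda)$, $\mathsf{h}(x;\lambda)$, $\mathsf{f}(x;\lambda)$ be the subspaces with frames $\mathbf{G}(x;\lambda)$, $\mathbf{H}(x;\lambda)$, $\mathbf{F}(x;\lambda)$, and let $\omega_1$ be the skew-symmetric $n$-linear map on $\mathbb{R}^{2n}$, all as defined in the context. (i) If $\omega_2$ is any skew-symmetric $n$-linear map on $\mathbb{R}^{2n}$ for which the triple $(\mathsf{f}(\cdot;\cdot),\omega_1,\omega_2)$ is invariant on the boundary of $[0,1]\times[\lambda_1,\lambda_2]$, then, with the generalized Maslov index $\operatorname{Ind}$ and the number $\mathfrak{m}$ computed using $\omega_1,\omega_2$, $$\mathcal{N}_{\#}([\lambda_1,\lambda_2])\ \ge\ \bigl|\operatorname{Ind}(\mathsf{g}(\cdot;\lambda_1),\mathsf{h}(\cdot;\lambda_2);[0,1])+\mathfrak{m}\bigr|.$$ (ii) Suppose additionally that Assumption (B) holds: for each $i$ the entry $a_{ii}(x;\lambda)$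 is independent of $\lambda$, and for all $i\neq j$ and all $\lambda\in[\lambda_1,\lambda_2]$ the difference $a_{ij}(x;\lambda)-a_{ij}(x;\lambda_2)$ is independent of $x$. Let $\omega_2$ be the particular skew-symmetric $n$-linear map $$\omega_2(f_1,\dots,f_n)=\sum_{k=1}^n\omega_1(f_1,\dots,\tilde{\mathbb{A}}(\lambda_1,\lambda_2)f_k,\dots,f_n)$$ with $\tilde{\mathbb{A}}(\lambda_1,\lambda_2)$ as defined in the context, and suppose (as in (i)) that the triple $(\mathsf{f}(\cdot;\cdot),\omega_1,\omega_2)$ is invariant on the boundary of $[0,1]\times[\lambda_1,\lambda_2]$. Then $$\operatorname{Ind}(\mathsf{g}(\cdot;\lambda_1),\mathsf{h}(\cdot;\lambda_2);[0,1])=\#\{x\in(0,1]:\ \mathsf{g}(x;\lambda_1)\cap\mathsf{h}(x;\lambda_2)\neq\{0\}\},$$ where the right-hand side is a direct count of the (necessarily discrete) number of values $x\in(0,1]$ at which the two subspaces intersect non-trivially (without multiplicity).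
   Context: Frames. A frame for an $r$-dimensional subspace of $\mathbb{R}^N$ is an $N\times r$ matrix whose columns form a basis of it. Fix frames $\mathbf{P}\in\mathbb{R}^{n\times m}$ of $\mathsf{p}$ and $\mathbf{Q}\in\mathbb{R}^{n\times(n-m)}$ of $\mathsf{q}$. $\mathbf{G}(x;\lambda)\in\mathbb{R}^{n\times m}$ solves $\mathbf{G}'=A(x;\lambda)\mathbf{G}$, $\mathbf{G}(0;\lambda)=\mathbf{P}$; $\mathbf{H}(x;\lambda)\in\mathbb{R}^{n\times(n-m)}$ solves $\mathbf{H}'=A(x;\lambda)\mathbf{H}$, $\mathbf{H}(1;\lambda)=\mathbf{Q}$ (primes are $x$-derivatives); and $$\mathbf{F}(x;\lambda)=\begin{pmatrix}\mathbf{G}(x;\lambda)&\mathbf{0}_{n\times(n-m)}\\ \mathbf{0}_{n\times m}&\mathbf{H}(x;\lambda_2)\end{pmatrix}\in\mathbb{R}^{2n\times n}$$ (note that $\mathbf{H}$ is evaluated at $\lambda_2$), with columns $f_1(x;\lambda),\dots,f_n(x;\lambda)$. The maps. $\omega_1(f_1,\dots,f_n)=\det(\mathbf{F}\ \ \tilde{\boldsymbol\Delta})$ for $f_1,\dots,f_n\in\mathbb{R}^{2n}$, where $\mathbf{F}=(f_1,\dots,f_n)$ and $\tilde{\boldsymbol\Delta}=\binom{-I_n}{I_n}$. For a skew-symmetric $n$-linear map $\omega_i$, write $\tilde\omega_i(x;\lambda)=\omega_i(f_1(x;\lambda),\dots,f_n(x;\lambda))$. One has $\tilde\omega_1(x;\lambda)=\det(\mathbf{G}(x;\lambda)\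 \ \mathbf{H}(x;\lambda_2))$. Let $\tilde A(\lambda)$ be the $n\times n$ matrix with zero diagonal and off-diagonal entries $a_{ij}(0;\lambda)$, $i\ne j$, and let $\tilde{\mathbb{A}}(\lambda_1,\lambda_2)=\begin{pmatrix}\tilde A(\lambda_1)&0\\0&\tilde A(\lambda_2)\end{pmatrix}$. Invariance. The triple $(\mathsf{f}(\cdot;\cdot),\omega_1,\omega_2)$ is invariant on the boundary of $[0,1]\times[\lambda_1,\lambda_2]$ if $\tilde\omega_1(x;\lambda)$ and $\tilde\omega_2(x;\lambda)$ do not vanish simultaneously at any point $(x,\lambda)$ of that boundary. Generalized Maslov index. Along a continuous path $t\in[a,b]$ (here, along one of the four sides of the rectangle) on which $(\tilde\omega_1(t),\tilde\omega_2(t))\ne(0,0)$, the index is the winding number in $\mathbb{R}P^1$ of $t\mapsto[\tilde\omega_1(t):\tilde\omega_2(t)]$ through $[0:1]$. Concretely, track the point $p(t)=\pm(\tilde\omega_2(t),\tilde\omega_1(t))/\sqrt{\tilde\omega_1(t)^2+\tilde\omega_2(t)^2}$, with sign $+$ if $\tilde\omega_2(t)\le0$ and $-$ if $\tilde\omega_2(t)>0$, in the left half of the unit circle, closed to $S^1$ by identifying $(0,1)$ with $(0,-1)$. Crossings of $(-1,0)$ are counted $+1$ if counterclockwise and $-1$ if clockwise. Counterclockwise arrivals at $(-1,0)$ contribute $+1$, clockwise departures contribute $-1$, and clockwise arrivals and counterclockwise departures contribute $0$ (also at endpoints, and when $p$ stays at $(-1,0)$ for an interval). Equivalently, if $\theta:[a,b]\to\mathbb{R}$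 is continuous with $(\tilde\omega_2(t),\tilde\omega_1(t))=R(t)(\cos\theta(t),\sin\theta(t))$, $R(t)>0$, the index equals $\lfloor\theta(b)/\pi\rfloor-\lfloor\theta(a)/\pi\rfloor$. The indices below denote this integer, computed along the path of $\mathsf{f}$ (with frame $\mathbf{F}$) over the indicated side: $\operatorname{Ind}(\mathsf{g}(x_0;\cdot),\mathsf{h}(x_0;\lambda_2);[\lambda_1,\lambda_2])$ for $\lambda\mapsto\mathsf{f}(x_0;\lambda)$, $\lambda$ increasing from $\lambda_1$ to $\lambda_2$; and $\operatorname{Ind}(\mathsf{g}(\cdot;\lambda_0),\mathsf{h}(\cdot;\lambda_2);[0,1])$ for $x\mapsto\mathsf{f}(x;\lambda_0)$, $x$ increasing from $0$ to $1$. The number $\mathfrak{m}$ is the index along the whole boundary: $$\mathfrak{m}=\operatorname{Ind}(\mathsf{g}(0;\cdot),\mathsf{h}(0;\lambda_2);[\lambda_1,\lambda_2])+\operatorname{Ind}(\mathsf{g}(\cdot;\lambda_2),\mathsf{h}(\cdot;\lambda_2);[0,1])-\operatorname{Ind}(\mathsf{g}(1;\cdot),\mathsf{h}(1;\lambda_2);[\lambda_1,\lambda_2])-\operatorname{Ind}(\mathsf{g}(\cdot;\lambda_1),\mathsf{h}(\cdot;\lambda_2);[0,1]).$$ Eigenvalues. $\lambda\in[\lambda_1,\lambda_2]$ is an eigenvalue if the boundary value problem has a nontrivial solution $y(\cdot;\lambda)\in C^1([0,1],\mathbb{R}^n)$. $\mathcal{N}_{\#}([\lambda_1,\lambda_2])$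 is the number of eigenvalues in $[\lambda_1,\lambda_2]$, counted without multiplicity, with the convention $\mathcal{N}_{\#}([\lambda_1,\lambda_2])=+\infty$ if the eigenvalues in $[\lambda_1,\lambda_2]$ do not form a discrete set. *)

theory Defs
  imports "HOL-Analysis.Analysis" "HOL-Library.Extended_Nat"
begin

text \<open>
  \<open>real^'c^'r\<close> is the type of matrices with rows indexed by \<open>'r\<close> and columns by \<open>'c\<close>.
  A sum of index types encodes concatenation, the \<open>Inl\<close> indices coming first.
\<close>

definition hcat :: "real^'c^'r \<Rightarrow> real^'d^'r \<Rightarrow> real^('c::finite + 'd::finite)^'r" where
  "hcat A B = (\<chi> i j. case j of Inl c \<Rightarrow> A $ i $ c | Inr d \<Rightarrow> B $ i $ d)"

definition vcat :: "real^'c^'r \<Rightarrow> real^'c^'s \<Rightarrow> real^'c^('r::finite + 's::finite)" where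
  "vcat A B = (\<chi> i. case i of Inl r \<Rightarrow> A $ r | Inr s \<Rightarrow> B $ s)"

definition is_frame :: "real^'r^'d \<Rightarrow> (real^'d) set \<Rightarrow> bool" where
  "is_frame M V \<longleftrightarrow>
     inj (\<lambda>j. column j M) \<and> independent (columns M) \<and> span (columns M) = V"

definition col_space :: "real^'r^'d \<Rightarrow> (real^'d) set" where
  "col_space M = span (columns M)"

definition multilinear :: "(('i \<Rightarrow> 'v::real_vector) \<Rightarrow> real) \<Rightarrow> bool" where
  "multilinear \<omega> \<longleftrightarrow> (\<forall>f k. linear (\<lambda>u. \<omega> (f(k := u))))"

definition skew_symmetric :: "(('i \<Rightarrow> 'v::real_vector) \<Rightarrow> real) \<Rightarrow> bool" where
  "skew_symmetric \<omega> \<longleftrightarrow> (\<forall>f i j. i \<noteq> j \<longrightarrow> \<omega> (f(i := f j, j := f i)) = - \<omega> f)"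

definition Delta_tilde :: "real^'n^('n::finite + 'n)" where
  "Delta_tilde = vcat (- mat 1) (mat 1)"

definition omega1 :: "('n::finite \<Rightarrow> real^('n + 'n)) \<Rightarrow> real" where
  "omega1 f = det (hcat (\<chi> i j. f j $ i) Delta_tilde)"

definition omega2_of :: "real^('n::finite + 'n)^('n + 'n) \<Rightarrow> ('n \<Rightarrow> real^('n + 'n)) \<Rightarrow> real" where
  "omega2_of M f = (\<Sum>k\<in>UNIV. omega1 (f(k := M *v f k)))"

definition assumption_A :: "(real \<Rightarrow> real \<Rightarrow> real^'n^'n) \<Rightarrow> real \<Rightarrow> real \<Rightarrow> bool" where
  "assumption_A A l1 l2 \<longleftrightarrow> continuous_on ({0..1} \<times> {l1..l2}) (\<lambda>(x, l). A x l)"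

definition assumption_B :: "(real \<Rightarrow> real \<Rightarrow> real^'n^'n) \<Rightarrow> real \<Rightarrow> real \<Rightarrow> bool" where
  "assumption_B A l1 l2 \<longleftrightarrow>
     (\<forall>i. \<forall>x\<in>{0..1}. \<forall>l\<in>{l1..l2}. \<forall>l'\<in>{l1..l2}. A x l $ i $ i = A x l' $ i $ i) \<and>
     (\<forall>i j. i \<noteq> j \<longrightarrow> (\<forall>l\<in>{l1..l2}. \<forall>x\<in>{0..1}. \<forall>x'\<in>{0..1}.
        A x l $ i $ j - A x l2 $ i $ j = A x' l $ i $ j - A x' l2 $ i $ j))"

definition is_eigenvalue ::
  "(real \<Rightarrow> real \<Rightarrow> real^'n^'n) \<Rightarrow> (real^'n) set \<Rightarrow> (real^'n) set \<Rightarrow> real \<Rightarrow> bool" where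
  "is_eigenvalue A p q l \<longleftrightarrow>
     (\<exists>y y'. continuous_on {0..1} y' \<and>
        (\<forall>x\<in>{0..1}. (y has_vector_derivative y' x) (at x within {0..1})) \<and>
        (\<forall>x\<in>{0<..<1}. y' x = A x l *v y x) \<and>
        y 0 \<in> p \<and> y 1 \<in> q \<and> (\<exists>x\<in>{0..1}. y x \<noteq> 0))"

text \<open>
  A finite set of reals is discrete, and an infinite one gets the value \<open>\<infinity>\<close> whether or not
  it is discrete. So the convention for non-discrete sets of eigenvalues is covered.
\<close>

definition num_eigenvalues ::
  "(real \<Rightarrow> real \<Rightarrow> real^'n^'n) \<Rightarrow> (real^'n) set \<Rightarrow> (real^'n) set \<Rightarrow> real \<Rightarrow> real \<Rightarrow> enat" where
  "num_eigenvalues A p q l1 l2 =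
     (let E = {l\<in>{l1..l2}. is_eigenvalue A p q l} in if finite E then enat (card E) else \<infinity>)"

definition solves_ode ::
  "(real \<Rightarrow> real \<Rightarrow> real^'n^'n) \<Rightarrow> real \<Rightarrow> real \<Rightarrow> (real \<Rightarrow> real \<Rightarrow> real^'r^'n) \<Rightarrow> bool" where
  "solves_ode A l1 l2 X \<longleftrightarrow>
     (\<forall>l\<in>{l1..l2}. \<forall>x\<in>{0..1}.
        ((\<lambda>x. X x l) has_vector_derivative A x l ** X x l) (at x within {0..1}))"

definition F_frame ::
  "(real \<Rightarrow> real \<Rightarrow> real^'m^('m::finite + 'k::finite)) \<Rightarrow> (real \<Rightarrow> real \<Rightarrow> real^'k^('m + 'k)) \<Rightarrow> real
     \<Rightarrow> real \<Rightarrow> real \<Rightarrow> real^('m + 'k)^(('m + 'k) + ('m + 'k))" where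
  "F_frame G H l2 x l = vcat (hcat (G x l) 0) (hcat 0 (H x l2))"

definition A_tilde :: "(real \<Rightarrow> real \<Rightarrow> real^'n^'n) \<Rightarrow> real \<Rightarrow> real^'n^'n" where
  "A_tilde A l = (\<chi> i j. if i = j then 0 else A 0 l $ i $ j)"

definition AA_tilde ::
  "(real \<Rightarrow> real \<Rightarrow> real^'n^'n) \<Rightarrow> real \<Rightarrow> real \<Rightarrow> real^('n::finite + 'n)^('n + 'n)" where
  "AA_tilde A l1 l2 = vcat (hcat (A_tilde A l1) 0) (hcat 0 (A_tilde A l2))"

definition polar_lift ::
  "real \<Rightarrow> real \<Rightarrow> (real \<Rightarrow> real) \<Rightarrow> (real \<Rightarrow> real) \<Rightarrow> (real \<Rightarrow> real) \<Rightarrow> bool" where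
  "polar_lift a b w1 w2 \<theta> \<longleftrightarrow>
     continuous_on {a..b} \<theta> \<and>
     (\<forall>t\<in>{a..b}. \<exists>R>0. w2 t = R * cos (\<theta> t) \<and> w1 t = R * sin (\<theta> t))"

text \<open>
  The winding number in the real projective line of \<open>t \<mapsto> [w1 t : w2 t]\<close> through \<open>[0 : 1]\<close>.
  The angle \<open>\<theta>\<close> passes a multiple of \<open>\<pi>\<close> exactly when the path meets \<open>[0 : 1]\<close>. The floors
  make a counterclockwise arrival count \<open>+1\<close>, a clockwise departure \<open>-1\<close>, and a clockwise
  arrival or counterclockwise departure \<open>0\<close>.
\<close>

definition maslov_ind :: "real \<Rightarrow> real \<Rightarrow> (real \<Rightarrow> real) \<Rightarrow> (real \<Rightarrow> real) \<Rightarrow> int" where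
  "maslov_ind a b w1 w2 =
     (THE k. \<exists>\<theta>. polar_lift a b w1 w2 \<theta> \<and> k = \<lfloor>\<theta> b / pi\<rfloor> - \<lfloor>\<theta> a / pi\<rfloor>)"

lemma polar_lift_exists:
  assumes "continuous_on {a..b} w1" "continuous_on {a..b} w2"
    and "\<And>t. t \<in> {a..b} \<Longrightarrow> (w1 t, w2 t) \<noteq> (0, 0)"
  shows "\<exists>\<theta>. polar_lift a b w1 w2 \<theta>"
proof -
  let ?z = "\<lambda>t. Complex (w2 t) (w1 t)"
  have "continuous_on {a..b} ?z"
    unfolding Complex_eq by (intro continuous_intros assms)
  moreover have "?z t \<noteq> 0" if "t \<in> {a..b}" for t
    using assms(3)[OF that] by (auto simp: complex_eq_iff)
  ultimately obtain g where g: "continuous_on {a..b} g"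
      and zg: "\<And>t. t \<in> {a..b} \<Longrightarrow> ?z t = exp (g t)"
    using continuous_logarithm_on_contractible[of "{a..b}" ?z]
      convex_imp_contractible[OF convex_closed_interval] by metis
  have "w2 t = exp (Re (g t)) * cos (Im (g t)) \<and> w1 t = exp (Re (g t)) * sin (Im (g t))"
    if "t \<in> {a..b}" for t
    using zg[OF that] by (metis Re_exp Im_exp complex.sel)
  then have "polar_lift a b w1 w2 (\<lambda>t. Im (g t))"
    unfolding polar_lift_def using g by (auto intro!: continuous_intros exI[of _ "exp _"])
  then show ?thesis by blast
qed

lemma maslov_ind_eq:
  assumes "a \<le> b" and lift: "polar_lift a b w1 w2 \<theta>"
  shows "maslov_ind a b w1 w2 = \<lfloor>\<theta> b / pi\<rfloor> - \<lfloor>\<theta> a / pi\<rfloor>"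
  unfolding maslov_ind_def
proof (rule the_equality)
  show "\<exists>\<theta>'. polar_lift a b w1 w2 \<theta>' \<and>
          \<lfloor>\<theta> b / pi\<rfloor> - \<lfloor>\<theta> a / pi\<rfloor> = \<lfloor>\<theta>' b / pi\<rfloor> - \<lfloor>\<theta>' a / pi\<rfloor>"
    using lift by blast
next
  fix k assume "\<exists>\<eta>. polar_lift a b w1 w2 \<eta> \<and> k = \<lfloor>\<eta> b / pi\<rfloor> - \<lfloor>\<eta> a / pi\<rfloor>"
  then obtain \<eta> where \<eta>: "polar_lift a b w1 w2 \<eta>" and k: "k = \<lfloor>\<eta> b / pi\<rfloor> - \<lfloor>\<eta> a / pi\<rfloor>"
    by blast
  let ?d = "\<lambda>t. (\<eta> t - \<theta> t) / (2 * pi)"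
  have int: "?d t \<in> \<int>" if t: "t \<in> {a..b}" for t
  proof -
    obtain R S where RS: "R > 0" "S > 0"
        and e: "R * cos (\<eta> t) = S * cos (\<theta> t)" "R * sin (\<eta> t) = S * sin (\<theta> t)"
      using \<eta> lift t unfolding polar_lift_def by metis
    have "(R * cos (\<eta> t))\<^sup>2 + (R * sin (\<eta> t))\<^sup>2 = R\<^sup>2"
         "(S * cos (\<theta> t))\<^sup>2 + (S * sin (\<theta> t))\<^sup>2 = S\<^sup>2"
      by (simp_all add: power_mult_distrib flip: distrib_left)
    then have "R = S" using e RS by (metis less_eq_real_def power2_eq_iff_nonneg)
    then obtain n :: int where "\<eta> t = \<theta> t + 2 * pi * n"
      using e RS sin_cos_eq_iff[of "\<eta> t" "\<theta> t"] by auto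
    then show ?thesis by simp
  qed
  have "continuous_on {a..b} ?d"
    using \<eta> lift unfolding polar_lift_def by (auto intro!: continuous_intros)
  moreover have "\<exists>e>0. \<forall>s. s \<in> {a..b} \<and> ?d s \<noteq> ?d t \<longrightarrow> e \<le> norm (?d s - ?d t)"
    if "t \<in> {a..b}" for t
  proof (intro exI[of _ 1] conjI allI impI)
    fix s assume s: "s \<in> {a..b} \<and> ?d s \<noteq> ?d t"
    then have "?d s - ?d t \<in> \<int>" "?d s - ?d t \<noteq> 0" using int that by (simp_all del: diff_divide_distrib)
    then show "1 \<le> norm (?d s - ?d t)" using Ints_nonzero_abs_ge1 by fastforce
  qed simp
  ultimately have "?d constant_on {a..b}"
    using connected_Icc by (intro continuous_discrete_range_constant) simp_all
  then have ab: "?d b = ?d a" using \<open>a \<le> b\<close> unfolding constant_on_def by force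
  obtain n where n: "?d a = of_int n" using int[of a] \<open>a \<le> b\<close> by (auto elim: Ints_cases)
  have "\<eta> c / pi = \<theta> c / pi + of_int (2 * n)" if "?d c = of_int n" for c
    using that by (simp add: field_simps)
  then have "\<lfloor>\<eta> c / pi\<rfloor> = \<lfloor>\<theta> c / pi\<rfloor> + 2 * n" if "?d c = of_int n" for c
    using that by (metis floor_add_int)
  then show "k = \<lfloor>\<theta> b / pi\<rfloor> - \<lfloor>\<theta> a / pi\<rfloor>" using k n ab by simp
qed

definition omega_along :: "(('n \<Rightarrow> real^'d) \<Rightarrow> real) \<Rightarrow> (real \<Rightarrow> real \<Rightarrow> real^'n^'d)
     \<Rightarrow> real \<Rightarrow> real \<Rightarrow> real" where
  "omega_along \<omega> F x l = \<omega> (\<lambda>j. column j (F x l))"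

definition invariant_on_boundary ::
  "(real \<Rightarrow> real \<Rightarrow> real^'n^'d) \<Rightarrow> (('n \<Rightarrow> real^'d) \<Rightarrow> real) \<Rightarrow> (('n \<Rightarrow> real^'d) \<Rightarrow> real)
     \<Rightarrow> real \<Rightarrow> real \<Rightarrow> bool" where
  "invariant_on_boundary F \<omega>1 \<omega>2 l1 l2 \<longleftrightarrow>
     (\<forall>(x, l) \<in> frontier ({0..1} \<times> {l1..l2}).
        \<not> (omega_along \<omega>1 F x l = 0 \<and> omega_along \<omega>2 F x l = 0))"

definition Ind_x ::
  "(real \<Rightarrow> real \<Rightarrow> real^'n^'d) \<Rightarrow> (('n \<Rightarrow> real^'d) \<Rightarrow> real) \<Rightarrow> (('n \<Rightarrow> real^'d) \<Rightarrow> real)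
     \<Rightarrow> real \<Rightarrow> int" where
  "Ind_x F \<omega>1 \<omega>2 l0 =
     maslov_ind 0 1 (\<lambda>x. omega_along \<omega>1 F x l0) (\<lambda>x. omega_along \<omega>2 F x l0)"

definition Ind_lambda ::
  "(real \<Rightarrow> real \<Rightarrow> real^'n^'d) \<Rightarrow> (('n \<Rightarrow> real^'d) \<Rightarrow> real) \<Rightarrow> (('n \<Rightarrow> real^'d) \<Rightarrow> real)
     \<Rightarrow> real \<Rightarrow> real \<Rightarrow> real \<Rightarrow> int" where
  "Ind_lambda F \<omega>1 \<omega>2 l1 l2 x0 =
     maslov_ind l1 l2 (\<lambda>l. omega_along \<omega>1 F x0 l) (\<lambda>l. omega_along \<omega>2 F x0 l)"

definition boundary_index ::
  "(real \<Rightarrow> real \<Rightarrow> real^'n^'d) \<Rightarrow> (('n \<Rightarrow> real^'d) \<Rightarrow> real) \<Rightarrow> (('n \<Rightarrow> real^'d) \<Rightarrow> real)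
     \<Rightarrow> real \<Rightarrow> real \<Rightarrow> int" where
  "boundary_index F \<omega>1 \<omega>2 l1 l2 =
     Ind_lambda F \<omega>1 \<omega>2 l1 l2 0 + Ind_x F \<omega>1 \<omega>2 l2
     - Ind_lambda F \<omega>1 \<omega>2 l1 l2 1 - Ind_x F \<omega>1 \<omega>2 l1"

end

theory Submission
  imports Defs
begin

text \<open>
  Let \<open>w1(x, \<lambda>)\<close> and \<open>w2(x, \<lambda>)\<close> be the values of \<open>\<omega>1\<close> and \<open>\<omega>2\<close> on the columns of the frame
  \<open>F(x, \<lambda>)\<close>, and let \<open>\<theta>\<close> be a continuous angle of \<open>(w2, w1)\<close> along a side of the rectangle. The
  angle is a multiple of \<open>\<pi>\<close> exactly at the zeros of \<open>w1\<close>, and the index is the change of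
  \<open>\<lfloor>\<theta> / \<pi>\<rfloor>\<close>. Moreover \<open>w1(x, \<lambda>) = 0\<close> says that \<open>G(x, \<lambda>) c + H(x, \<lambda>2) d = 0\<close> for some
  \<open>(c, d) \<noteq> (0, 0)\<close>: the two subspaces meet, and at \<open>x = 1\<close> the solution \<open>G(\<cdot>, \<lambda>) c\<close> satisfies
  both boundary conditions.

  For the lower bound, note that by definition of the boundary index its sum with the index
  along \<open>\<lambda> = \<lambda>1\<close> involves only the other three sides. Along \<open>x = 0\<close> the frame is constant, so
  the index is \<open>0\<close>. Along \<open>\<lambda> = \<lambda>2\<close> both \<open>G\<close> and \<open>H\<close> solve the same linear system, and Abel's
  formula \<open>w1' = trace A \<cdot> w1\<close> shows that \<open>w1\<close> vanishes everywhere or nowhere. In both cases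
  \<open>\<lfloor>\<theta> / \<pi>\<rfloor>\<close> does not change. What remains is minus the index along \<open>x = 1\<close>. By the intermediate
  value theorem \<open>\<lfloor>\<theta> / \<pi>\<rfloor>\<close> can change by \<open>N\<close> only if \<open>\<theta>\<close> takes \<open>N\<close> distinct multiples of \<open>\<pi>\<close> as
  values, hence at \<open>N\<close> distinct zeros of \<open>w1(1, \<cdot>)\<close>, and these are eigenvalues
  (\<open>num_eigenvalues_ge_Ind_lambda\<close>). The angle exists on this side because solutions depend
  continuously on \<open>\<lambda>\<close>, which is a Gronwall estimate (\<open>continuous_on_parameter\<close>).

  For the exact count, under the second assumption \<open>A(x, \<lambda>1)\<close> and \<open>A(x, \<lambda>2)\<close> exceed the constant
  matrices \<open>A_tilde\<close> at \<open>\<lambda>1\<close> and \<open>\<lambda>2\<close> by one and the same matrix \<open>B(x)\<close>. Applying \<open>B(x)\<close> to both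
  halves of the frame as a derivation only multiplies \<open>\<omega>1\<close> by \<open>trace (B(x))\<close>
  (\<open>omega2_of_block_diag\<close>), so \<open>w1' = w2 + trace B \<cdot> w1\<close> along \<open>\<lambda> = \<lambda>1\<close>. At a zero of \<open>w1\<close> this
  gives \<open>w1' \<cdot> w2 = w2\<^sup>2 > 0\<close>, which means that \<open>\<theta>\<close> crosses that multiple of \<open>\<pi>\<close> upwards. Hence
  each multiple of \<open>\<pi>\<close> is met at most once, and the index is the number of zeros in \<open>(0, 1]\<close>
  (\<open>maslov_ind_eq_card_zeros\<close>).
\<close>

section \<open>Multilinear maps along differentiable paths\<close>

lemma multilinear_expand:
  fixes \<omega> :: "('i \<Rightarrow> real^'d) \<Rightarrow> real"
  assumes "multilinear \<omega>"
  shows "\<omega> (f(k := u)) = (\<Sum>b\<in>UNIV. u $ b * \<omega> (f(k := axis b 1)))"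
proof -
  interpret L: linear "\<lambda>u. \<omega> (f(k := u))"
    using assms unfolding multilinear_def by blast
  have "\<omega> (f(k := u)) = \<omega> (f(k := (\<Sum>b\<in>UNIV. u $ b *\<^sub>R axis b 1)))"
    using basis_expansion[of u] by (simp add: scalar_mult_eq_scaleR)
  also have "\<dots> = (\<Sum>b\<in>UNIV. u $ b * \<omega> (f(k := axis b 1)))"
    by (simp add: L.sum L.scale)
  finally show ?thesis .
qed

text \<open>
  Expanding one slot in the standard basis writes the map as a sum of products of coordinates
  with the same map in which that slot is constant. So the slots can be made variable one at a
  time: in the induction those in \<open>T\<close> vary and the others are frozen at \<open>g\<close>.
\<close>

lemma continuous_on_multilinear:
  fixes \<omega> :: "('i::finite \<Rightarrow> real^'d) \<Rightarrow> real"
  assumes \<omega>: "multilinear \<omega>" and f: "\<And>j. continuous_on S (\<lambda>x. f x j)"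
  shows "continuous_on S (\<lambda>x. \<omega> (f x))"
proof -
  have "continuous_on S (\<lambda>x. \<omega> (\<lambda>j. if j \<in> T then f x j else g j))" for T g
    using finite[of T]
  proof (induction T arbitrary: g rule: finite_induct)
    case (insert k T)
    have *: "(\<lambda>j. if j \<in> insert k T then f x j else g j)
        = (\<lambda>j. if j \<in> T then f x j else g j)(k := f x k)" for x
      by auto
    have **: "(\<lambda>j. if j \<in> T then f x j else g j)(k := v)
        = (\<lambda>j. if j \<in> T then f x j else (g(k := v)) j)" for x v
      using insert.hyps by auto
    have "\<omega> (\<lambda>j. if j \<in> insert k T then f x j else g j)
        = (\<Sum>b\<in>UNIV. f x k $ b * \<omega> (\<lambda>j. if j \<in> T then f x j else (g(k := axis b 1)) j))" for x
      unfolding * by (subst multilinear_expand[OF \<omega>]) (simp only: **)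
    then show ?case
      by (simp only:) (intro continuous_intros f insert.IH)
  qed auto
  from this[of UNIV] show ?thesis by simp
qed

text \<open>
  The product rule for multilinear maps, by the same induction over the set \<open>T\<close> of varying
  slots.
\<close>

lemma has_real_derivative_multilinear:
  fixes \<omega> :: "('i::finite \<Rightarrow> real^'d) \<Rightarrow> real"
  assumes \<omega>: "multilinear \<omega>"
    and f: "\<And>j. ((\<lambda>x. f x j) has_vector_derivative f' j) (at x within S)"
  shows "((\<lambda>x. \<omega> (f x)) has_real_derivative (\<Sum>k\<in>UNIV. \<omega> ((f x)(k := f' k)))) (at x within S)"
proof -
  have comp: "((\<lambda>x. f x k $ b) has_real_derivative f' k $ b) (at x within S)" for k b
    using bounded_linear.has_vector_derivative[OF bounded_linear_vec_nth f]
    by (simp add: has_real_derivative_iff_has_vector_derivative)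
  have "((\<lambda>x. \<omega> (\<lambda>j. if j \<in> T then f x j else g j)) has_real_derivative
      (\<Sum>k\<in>T. \<omega> ((\<lambda>j. if j \<in> T then f x j else g j)(k := f' k)))) (at x within S)" for T g
    using finite[of T]
  proof (induction T arbitrary: g rule: finite_induct)
    case (insert k T)
    have *: "(\<lambda>j. if j \<in> insert k T then f x j else g j)
        = (\<lambda>j. if j \<in> T then f x j else g j)(k := f x k)" for x
      by auto
    have **: "(\<lambda>j. if j \<in> T then f x j else g j)(k := v)
        = (\<lambda>j. if j \<in> T then f x j else (g(k := v)) j)" for x v
      using insert.hyps by auto
    let ?h = "\<lambda>y v j. if j \<in> T then f y j else (g(k := v)) j"
    have "((\<lambda>y. \<Sum>b\<in>UNIV. f y k $ b * \<omega> (?h y (axis b 1))) has_real_derivative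
        (\<Sum>b\<in>UNIV. f' k $ b * \<omega> (?h x (axis b 1))
          + (\<Sum>i\<in>T. \<omega> ((?h x (axis b 1))(i := f' i))) * f x k $ b)) (at x within S)"
      by (intro DERIV_sum DERIV_mult comp insert.IH)
    moreover have "(\<Sum>b\<in>UNIV. f' k $ b * \<omega> (?h x (axis b 1))) = \<omega> (?h x (f' k))"
      using multilinear_expand[OF \<omega>, of "\<lambda>j. if j \<in> T then f x j else g j" k "f' k"]
      unfolding ** by simp
    moreover have "(\<Sum>b\<in>UNIV. \<omega> ((?h x (axis b 1))(i := f' i)) * f x k $ b)
        = \<omega> ((?h x (f x k))(i := f' i))" if "i \<in> T" for i
    proof -
      \<comment> \<open>The slot \<open>i\<close> is being differentiated, so slot \<open>k\<close> can be expanded and collected again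
        around it.\<close>
      have "i \<noteq> k" using that insert.hyps by auto
      then have e: "(?h x v)(i := f' i) = ((?h x undefined)(i := f' i))(k := v)" for v
        using insert.hyps by (auto simp: fun_eq_iff)
      show ?thesis
        unfolding e[of "f x k"] multilinear_expand[OF \<omega>, of _ k "f x k"] e[of "axis _ 1"]
        by (simp add: mult.commute)
    qed
    then have "(\<Sum>b\<in>UNIV. (\<Sum>i\<in>T. \<omega> ((?h x (axis b 1))(i := f' i))) * f x k $ b)
        = (\<Sum>i\<in>T. \<omega> ((?h x (f x k))(i := f' i)))"
      unfolding sum_distrib_right by (subst sum.swap) (auto intro: sum.cong)
    ultimately have "((\<lambda>y. \<Sum>b\<in>UNIV. f y k $ b * \<omega> (?h y (axis b 1))) has_real_derivative
        \<omega> (?h x (f' k)) + (\<Sum>i\<in>T. \<omega> ((?h x (f x k))(i := f' i)))) (at x within S)"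
      by (simp add: sum.distrib)
    moreover have "\<omega> (\<lambda>j. if j \<in> insert k T then f y j else g j)
        = (\<Sum>b\<in>UNIV. f y k $ b * \<omega> (?h y (axis b 1)))" for y
      unfolding * by (subst multilinear_expand[OF \<omega>]) (simp only: **)
    moreover have "(\<lambda>j. if j \<in> insert k T then f x j else g j) = ?h x (f x k)"
        "(?h x (f x k))(k := f' k) = ?h x (f' k)"
      using insert.hyps by (auto simp: fun_eq_iff)
    ultimately show ?case
      unfolding sum.insert[OF insert.hyps] by (simp only:)
  qed auto
  from this[of UNIV] show ?thesis by simp
qed

section \<open>Determinants under a derivation\<close>

lemma multilinear_det_columns:
  "multilinear (\<lambda>f :: 'n::finite \<Rightarrow> real^'n. det (\<chi> i j. f j $ i))"
  unfolding multilinear_def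
proof (intro allI linearI)
  fix f :: "'n \<Rightarrow> real^'n" and k u v and r :: real
  have t: "det (\<chi> i j. (f(k := u)) j $ i) = det (\<chi> j. if j = k then u else f j)" for u
    by (subst det_transpose[symmetric], rule arg_cong[of _ _ det]) (simp add: transpose_def vec_eq_iff)
  show "det (\<chi> i j. (f(k := u + v)) j $ i)
      = det (\<chi> i j. (f(k := u)) j $ i) + det (\<chi> i j. (f(k := v)) j $ i)"
    unfolding t by (rule det_row_add)
  show "det (\<chi> i j. (f(k := r *\<^sub>R u)) j $ i) = r *\<^sub>R det (\<chi> i j. (f(k := u)) j $ i)"
    unfolding t using det_row_mul[of k r "\<lambda>_. u" f] unfolding scalar_mult_eq_scaleR by simp
qed

text \<open>
  Both sides are the derivative at \<open>t = 0\<close> of \<open>det (X + t M X) = det (1 + t M) det X\<close>. This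
  argument also covers singular \<open>X\<close>, which is the case of interest at the zeros of \<open>\<omega>1\<close>.
\<close>

lemma sum_det_derivation:
  fixes M X :: "real^'n^'n"
  shows "(\<Sum>k\<in>UNIV. det (\<chi> i j. if j = k then (M ** X) $ i $ j else X $ i $ j)) = trace M * det X"
proof -
  let ?\<omega> = "\<lambda>f :: 'n \<Rightarrow> real^'n. det (\<chi> i j. f j $ i)"
  let ?p = "\<lambda>t. det (mat 1 + t *\<^sub>R M)"
  let ?s = "\<lambda>X. \<Sum>k\<in>UNIV. det (\<chi> i j. if j = k then (M ** X) $ i $ j else X $ i $ j)"
  have D: "((\<lambda>t. ?p t * det X) has_real_derivative ?s X) (at 0)" for X
  proof -
    have "((\<lambda>t. ?\<omega> (\<lambda>j. column j X + t *\<^sub>R column j (M ** X))) has_real_derivative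
        (\<Sum>k\<in>UNIV. ?\<omega> ((\<lambda>j. column j X + 0 *\<^sub>R column j (M ** X))(k := column k (M ** X))))) (at 0)"
      by (rule has_real_derivative_multilinear[OF multilinear_det_columns])
         (auto intro!: derivative_eq_intros)
    moreover have "?\<omega> (\<lambda>j. column j X + t *\<^sub>R column j (M ** X)) = ?p t * det X" for t
    proof -
      have "(\<chi> i j. (column j X + t *\<^sub>R column j (M ** X)) $ i) = (mat 1 + t *\<^sub>R M) ** X"
        by (simp add: vec_eq_iff column_def matrix_matrix_mult_def mat_def distrib_right sum.distrib
            sum_distrib_left mult.assoc if_distrib[of "\<lambda>x. x * _"] cong: if_cong)
      then show ?thesis by (simp add: det_mul)
    qed
    moreover have "(\<chi> i j. ((\<lambda>j. column j X + 0 *\<^sub>R column j (M ** X))(k := column k (M ** X))) j $ i)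
        = (\<chi> i j. if j = k then (M ** X) $ i $ j else X $ i $ j)" for k
      by (simp add: vec_eq_iff column_def)
    ultimately show ?thesis by simp
  qed
  \<comment> \<open>The derivative of \<open>det (1 + t M)\<close> is read off from the case \<open>X = 1\<close>.\<close>
  have "?s (mat 1) = trace M"
  proof -
    have "det (\<chi> i j. if j = k then (M ** mat 1) $ i $ j else mat 1 $ i $ j) = M $ k $ k" for k
    proof -
      have "(\<chi> i j. if j = k then (M ** mat 1) $ i $ j else mat 1 $ i $ j)
          = (\<chi> i j. if j = k then (mat 1 *v column k M) $ i else mat 1 $ i $ j)"
        by (simp add: vec_eq_iff column_def)
      then show ?thesis by (simp only: cramer_lemma) (simp add: column_def)
    qed
    then show ?thesis by (simp add: trace_def)
  qed
  with D[of "mat 1"] have "((\<lambda>t. ?p t * det X) has_real_derivative trace M * det X) (at 0)"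
    by (auto intro!: derivative_eq_intros)
  with D[of X] show ?thesis by (rule DERIV_unique)
qed

lemma sum_Plus_UNIV: "(\<Sum>i\<in>UNIV. f i) = (\<Sum>a\<in>UNIV. f (Inl a)) + (\<Sum>b\<in>UNIV. f (Inr b))"
  for f :: "'a::finite + 'b::finite \<Rightarrow> 'c::comm_monoid_add"
  by (simp add: sum.Plus UNIV_Plus_UNIV[symmetric] del: UNIV_Plus_UNIV)

lemma multilinear_omega1: "multilinear omega1"
  unfolding multilinear_def
proof (intro allI)
  fix f :: "'n::finite \<Rightarrow> real^('n + 'n)" and k
  let ?g = "\<lambda>j. case j of Inl c \<Rightarrow> f c | Inr d \<Rightarrow> column d Delta_tilde"
  have "omega1 (f(k := u)) = det (\<chi> i j. (?g(Inl k := u)) j $ i)" for u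
    unfolding omega1_def
    by (intro arg_cong[of _ _ det]) (auto simp: hcat_def vec_eq_iff column_def split: sum.splits)
  then show "linear (\<lambda>u. omega1 (f(k := u)))"
    using multilinear_det_columns[where 'n = "'n + 'n"] unfolding multilinear_def by simp
qed

definition block_diag :: "real^'n^'n \<Rightarrow> real^'n^'n \<Rightarrow> real^('n::finite + 'n)^('n + 'n)" where
  "block_diag A B = vcat (hcat A 0) (hcat 0 B)"

definition embed_upper :: "real^'n \<Rightarrow> real^('n::finite + 'n)" where
  "embed_upper u = (\<chi> i. case i of Inl a \<Rightarrow> u $ a | Inr _ \<Rightarrow> 0)"

definition embed_lower :: "real^'n \<Rightarrow> real^('n::finite + 'n)" where
  "embed_lower u = (\<chi> i. case i of Inl _ \<Rightarrow> 0 | Inr a \<Rightarrow> u $ a)"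

text \<open>
  \<open>\<omega>1 f\<close> is a determinant of size \<open>2n\<close>, and \<open>block_diag B B\<close>, whose trace is \<open>2 trace B\<close>, acts
  on all its columns with total effect \<open>2 trace B\<close>. The block \<open>Delta_tilde\<close> intertwines
  \<open>block_diag B B\<close> with \<open>B\<close>, so its columns account for \<open>trace B\<close>; the same amount is left for
  the columns of \<open>f\<close>.
\<close>

lemma omega2_of_block_diag:
  fixes f :: "'n::finite \<Rightarrow> real^('n + 'n)" and B :: "real^'n^'n"
  shows "omega2_of (block_diag B B) f = trace B * omega1 f"
proof -
  let ?M = "block_diag B B"
  define X where "X = hcat (\<chi> i j. f j $ i) (Delta_tilde :: real^'n^('n+'n))"
  let ?d = "\<lambda>k. det (\<chi> i j. if j = k then (?M ** X) $ i $ j else X $ i $ j)"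
  have "?d (Inl k) = omega1 (f(k := ?M *v f k))" for k
    unfolding omega1_def X_def
    by (intro arg_cong[of _ _ det])
       (auto simp: hcat_def vec_eq_iff matrix_matrix_mult_def matrix_vector_mult_def split: sum.splits)
  \<comment> \<open>\<open>block_diag B B\<close> sends column \<open>k\<close> of \<open>Delta_tilde\<close> to the combination of its columns with
    coefficients \<open>B e\<^sub>k\<close>, and Cramer's rule keeps only the diagonal coefficient.\<close>
  moreover have "?d (Inr k) = B $ k $ k * omega1 f" for k
  proof -
    have "(?M ** X) $ i $ Inr k = (X *v embed_lower (column k B)) $ i" for i
      by (cases i) (simp_all add: X_def matrix_matrix_mult_def matrix_vector_mult_def sum_Plus_UNIV embed_lower_def
          block_diag_def vcat_def hcat_def Delta_tilde_def mat_def column_def if_distrib[of "\<lambda>x. _ * x"]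
          if_distrib[of "\<lambda>x. x * _"] sum_negf cong: if_cong)
    then have "(\<chi> i j. if j = Inr k then (?M ** X) $ i $ j else X $ i $ j)
        = (\<chi> i j. if j = Inr k then (X *v embed_lower (column k B)) $ i else X $ i $ j)"
      by (simp add: vec_eq_iff)
    then have "?d (Inr k) = embed_lower (column k B) $ Inr k * det X"
      by (simp only: cramer_lemma)
    then show ?thesis by (simp add: X_def omega1_def embed_lower_def column_def)
  qed
  ultimately have "(\<Sum>k\<in>UNIV. ?d k) = omega2_of ?M f + trace B * omega1 f"
    by (simp add: sum_Plus_UNIV omega2_of_def trace_def sum_distrib_right)
  moreover have "trace ?M = 2 * trace B"
    by (simp add: trace_def sum_Plus_UNIV block_diag_def vcat_def hcat_def)
  ultimately show ?thesis
    using sum_det_derivation[of ?M X] by (simp add: X_def omega1_def)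
qed

lemma omega2_of_add: "omega2_of (M + N) f = omega2_of M f + omega2_of N f"
proof -
  have "linear (\<lambda>u. omega1 (f(k := u)))" for k
    using multilinear_omega1 unfolding multilinear_def by blast
  then show ?thesis
    unfolding omega2_of_def matrix_vector_mult_add_rdistrib
    by (simp add: linear_add[of "\<lambda>u. omega1 (f(_ := u))"] sum.distrib)
qed

section \<open>The index and the zeros of the first coordinate\<close>

lemma polar_lift_zero_iff:
  assumes "polar_lift a b w1 w2 \<theta>" "t \<in> {a..b}"
  shows "w1 t = 0 \<longleftrightarrow> (\<exists>k::int. \<theta> t = of_int k * pi)"
proof -
  obtain R where "R > 0" "w1 t = R * sin (\<theta> t)"
    using assms unfolding polar_lift_def by blast
  then show ?thesis using sin_zero_iff_int2[of "\<theta> t"] by auto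
qed

lemma of_int_times_pi_le_iff: "of_int k * pi \<le> y \<longleftrightarrow> k \<le> \<lfloor>y / pi\<rfloor>"
  by (simp add: le_floor_iff pos_le_divide_eq)

text \<open>
  By the intermediate value theorem the angle takes as value every multiple of \<open>\<pi>\<close> that the
  floors at the two ends count, whatever the direction of rotation, and each of these values
  needs a zero of \<open>w1\<close> of its own.
\<close>

lemma abs_maslov_ind_le_card_zeros:
  assumes "a \<le> b" and lift: "polar_lift a b w1 w2 \<theta>" and fin: "finite {t \<in> {a..b}. w1 t = 0}"
  shows "\<bar>maslov_ind a b w1 w2\<bar> \<le> int (card {t \<in> {a..b}. w1 t = 0})"
proof -
  let ?K = "{\<lfloor>\<theta> a / pi\<rfloor> <.. \<lfloor>\<theta> b / pi\<rfloor>} \<union> {\<lfloor>\<theta> b / pi\<rfloor> <.. \<lfloor>\<theta> a / pi\<rfloor>}"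
  have cont: "continuous_on {a..b} \<theta>" using lift unfolding polar_lift_def by blast
  have "?K \<subseteq> (\<lambda>t. \<lfloor>\<theta> t / pi\<rfloor>) ` {t \<in> {a..b}. w1 t = 0}"
  proof
    fix k assume "k \<in> ?K"
    then have "\<theta> a \<le> of_int k * pi \<and> of_int k * pi \<le> \<theta> b \<or> \<theta> b \<le> of_int k * pi \<and> of_int k * pi \<le> \<theta> a"
      using of_int_times_pi_le_iff[of k "\<theta> a"] of_int_times_pi_le_iff[of k "\<theta> b"]
      by (auto simp: not_le[symmetric])
    then obtain t where t: "t \<in> {a..b}" "\<theta> t = of_int k * pi"
      using IVT'[of \<theta> a "of_int k * pi" b] IVT2'[of \<theta> b "of_int k * pi" a] cont \<open>a \<le> b\<close> by auto
    then have "w1 t = 0" using polar_lift_zero_iff[OF lift] by blast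
    then show "k \<in> (\<lambda>t. \<lfloor>\<theta> t / pi\<rfloor>) ` {t \<in> {a..b}. w1 t = 0}"
      using t by (intro image_eqI[of _ _ t]) simp_all
  qed
  then have "card ?K \<le> card {t \<in> {a..b}. w1 t = 0}"
    using fin by (rule surj_card_le[rotated])
  moreover have "int (card ?K) = \<bar>\<lfloor>\<theta> b / pi\<rfloor> - \<lfloor>\<theta> a / pi\<rfloor>\<bar>"
    by (cases "\<lfloor>\<theta> a / pi\<rfloor> \<le> \<lfloor>\<theta> b / pi\<rfloor>") (simp_all del: floor_divide_of_int_eq)
  ultimately show ?thesis using maslov_ind_eq[OF \<open>a \<le> b\<close> lift] by simp
qed

text \<open>
  The angle is continuous with values in the discrete set of multiples of \<open>\<pi>\<close>, hence constant.
\<close>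

lemma maslov_ind_eq_0_if_constantly_zero:
  assumes "a \<le> b" and lift: "polar_lift a b w1 w2 \<theta>" and zero: "\<And>t. t \<in> {a..b} \<Longrightarrow> w1 t = 0"
  shows "maslov_ind a b w1 w2 = 0"
proof -
  have "continuous_on {a..b} (\<lambda>t. \<theta> t / pi)"
    using lift unfolding polar_lift_def by (auto intro!: continuous_intros)
  moreover have int: "\<theta> t / pi \<in> \<int>" if "t \<in> {a..b}" for t
    using polar_lift_zero_iff[OF lift that] zero[OF that] by (metis Ints_of_int nonzero_mult_div_cancel_right pi_neq_zero)
  have "\<exists>e>0. \<forall>s. s \<in> {a..b} \<and> \<theta> s / pi \<noteq> \<theta> t / pi \<longrightarrow> e \<le> norm (\<theta> s / pi - \<theta> t / pi)"
    if "t \<in> {a..b}" for t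
  proof (intro exI[of _ 1] conjI allI impI)
    fix s assume s: "s \<in> {a..b} \<and> \<theta> s / pi \<noteq> \<theta> t / pi"
    then have "\<theta> s / pi - \<theta> t / pi \<in> \<int>" "\<theta> s / pi - \<theta> t / pi \<noteq> 0"
      using int that by (blast intro: Ints_diff, metis right_minus_eq)
    then show "1 \<le> norm (\<theta> s / pi - \<theta> t / pi)"
      unfolding real_norm_def by (rule Ints_nonzero_abs_ge1)
  qed simp
  ultimately have "(\<lambda>t. \<theta> t / pi) constant_on {a..b}"
    using connected_Icc by (intro continuous_discrete_range_constant) simp_all
  then have "\<theta> b / pi = \<theta> a / pi" using \<open>a \<le> b\<close> unfolding constant_on_def by force
  then show ?thesis using maslov_ind_eq[OF \<open>a \<le> b\<close> lift] by simp
qed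

lemma maslov_ind_constant_path:
  assumes "a \<le> b" and nz: "(w1 a, w2 a) \<noteq> (0, 0)"
    and const: "\<And>t. t \<in> {a..b} \<Longrightarrow> w1 t = w1 a" "\<And>t. t \<in> {a..b} \<Longrightarrow> w2 t = w2 a"
  shows "maslov_ind a b w1 w2 = 0"
proof -
  \<comment> \<open>An angle of the single point at \<open>a\<close>, kept constant, is an angle of the whole path.\<close>
  obtain \<theta> where "polar_lift a a w1 w2 \<theta>"
    using polar_lift_exists[of a a w1 w2] nz by auto
  then obtain R where "R > 0" "w2 a = R * cos (\<theta> a)" "w1 a = R * sin (\<theta> a)"
    unfolding polar_lift_def by auto
  then have "polar_lift a b w1 w2 (\<lambda>_. \<theta> a)"
    unfolding polar_lift_def using const by (intro conjI ballI exI[of _ R] continuous_on_const) metis+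
  from maslov_ind_eq[OF \<open>a \<le> b\<close> this] show ?thesis by simp
qed

text \<open>
  A return to the level \<open>y\<close> would have a first time \<open>m\<close>, and there the function would arrive
  from above. But an upcrossing at \<open>m\<close> forces values below \<open>y\<close> just before \<open>m\<close>, and then the
  intermediate value theorem gives an even earlier return.
\<close>

lemma upcrossing_stays_above:
  fixes \<theta> :: "real \<Rightarrow> real"
  assumes cont: "continuous_on {a..b} \<theta>"
    and up: "\<And>t. \<lbrakk>t \<in> {a..b}; \<theta> t = y\<rbrakk> \<Longrightarrow> \<exists>\<delta>>0. \<forall>s\<in>{a..b}.
               (t < s \<longrightarrow> s < t + \<delta> \<longrightarrow> y < \<theta> s) \<and> (t - \<delta> < s \<longrightarrow> s < t \<longrightarrow> \<theta> s < y)"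
    and t: "t \<in> {a..b}" "\<theta> t = y" and s: "s \<in> {a..b}" "t < s"
  shows "y < \<theta> s"
proof (rule ccontr)
  assume "\<not> y < \<theta> s"
  obtain \<delta> where "\<delta> > 0" and d: "\<And>s. \<lbrakk>s \<in> {a..b}; t < s; s < t + \<delta>\<rbrakk> \<Longrightarrow> y < \<theta> s"
    using up[OF t] by blast
  \<comment> \<open>A point past \<open>t\<close> but still inside the interval where \<open>\<theta> > y\<close>: the search for a return has
    to start to the right of \<open>t\<close> itself.\<close>
  define c where "c = t + \<delta> / 2"
  have "t + \<delta> \<le> s" using d[of s] s \<open>\<not> y < \<theta> s\<close> by linarith
  then have c: "t < c" "c < s" "c < t + \<delta>" using \<open>\<delta> > 0\<close> by (simp_all add: c_def)
  then have c: "t < c" "c < s" "y < \<theta> c" using d[of c] s t by auto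
  have hit: "\<exists>m. c \<le> m \<and> m \<le> r \<and> \<theta> m = y" if "c \<le> r" "r \<le> s" "\<theta> r \<le> y" for r
    using that c s t by (intro IVT2' continuous_on_subset[OF cont]) auto
  define C where "C = {c..s} \<inter> \<theta> -` {y}"
  have "closed C" unfolding C_def
    using c s t by (intro continuous_closed_preimage continuous_on_subset[OF cont]) auto
  moreover have "C \<noteq> {}" using hit[of s] c \<open>\<not> y < \<theta> s\<close> by (auto simp: C_def)
  moreover have bdd: "bdd_below C" by (auto simp: C_def bdd_below_def)
  ultimately have "Inf C \<in> C" by (intro closed_contains_Inf)
  then have m: "c \<le> Inf C" "Inf C \<le> s" "\<theta> (Inf C) = y" by (auto simp: C_def)
  with c have "c < Inf C" by (cases "c = Inf C") auto
  obtain \<epsilon> where "\<epsilon> > 0" and e: "\<And>s. \<lbrakk>s \<in> {a..b}; Inf C - \<epsilon> < s; s < Inf C\<rbrakk> \<Longrightarrow> \<theta> s < y"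
    using up[of "Inf C"] m c s t by auto
  obtain r where r: "max c (Inf C - \<epsilon>) < r" "r < Inf C"
    using dense[of "max c (Inf C - \<epsilon>)" "Inf C"] \<open>c < Inf C\<close> \<open>\<epsilon> > 0\<close> by auto
  then have "\<theta> r < y" using e[of r] m c s t by auto
  then obtain m' where "c \<le> m'" "m' \<le> r" "\<theta> m' = y" using hit[of r] r m by auto
  then have "m' \<in> C" using r m by (auto simp: C_def)
  then have "Inf C \<le> m'" using bdd by (rule cInf_lower)
  then show False using \<open>m' \<le> r\<close> r by simp
qed

text \<open>
  If \<open>\<theta> s \<ge> y\<close>, then \<open>\<theta>\<close> would have to meet \<open>y\<close> between \<open>s\<close> and \<open>t\<close>, because it is below \<open>y\<close>
  just before \<open>t\<close>. After that meeting it would stay above \<open>y\<close>, and could not return to \<open>y\<close> at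
  \<open>t\<close>.
\<close>

lemma upcrossing_stays_below:
  fixes \<theta> :: "real \<Rightarrow> real"
  assumes cont: "continuous_on {a..b} \<theta>"
    and up: "\<And>t. \<lbrakk>t \<in> {a..b}; \<theta> t = y\<rbrakk> \<Longrightarrow> \<exists>\<delta>>0. \<forall>s\<in>{a..b}.
               (t < s \<longrightarrow> s < t + \<delta> \<longrightarrow> y < \<theta> s) \<and> (t - \<delta> < s \<longrightarrow> s < t \<longrightarrow> \<theta> s < y)"
    and t: "t \<in> {a..b}" "\<theta> t = y" and s: "s \<in> {a..b}" "s < t"
  shows "\<theta> s < y"
proof (rule ccontr)
  assume ge: "\<not> \<theta> s < y"
  obtain \<delta> where "\<delta> > 0" and d: "\<And>s. \<lbrakk>s \<in> {a..b}; t - \<delta> < s; s < t\<rbrakk> \<Longrightarrow> \<theta> s < y"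
    using up[OF t] by blast
  obtain r where r: "max s (t - \<delta>) < r" "r < t"
    using dense[of "max s (t - \<delta>)" t] \<open>\<delta> > 0\<close> s by auto
  then have "\<theta> r < y" using d[of r] s t by auto
  then obtain m where "s \<le> m" "m \<le> r" "\<theta> m = y"
    using IVT2'[of \<theta> r y s] ge r s t continuous_on_subset[OF cont, of "{s..r}"] by auto
  then show False
    using upcrossing_stays_above[OF cont up, where t = m and s = t] r s t by auto
qed

text \<open>
  Near a zero \<open>t\<close> of \<open>w1\<close>, the difference \<open>\<theta> s - \<theta> t\<close> has the sign of \<open>sin (\<theta> s - \<theta> t)\<close>, which
  is the sign of \<open>w1 s \<cdot> cos (\<theta> t)\<close> since \<open>sin (\<theta> t) = 0\<close>. The latter function of \<open>s\<close> has
  positive derivative at \<open>t\<close>, because \<open>D \<cdot> w2 t > 0\<close> and \<open>cos (\<theta> t)\<close> has the sign of \<open>w2 t\<close>.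
\<close>

lemma polar_lift_upcrossing:
  assumes lift: "polar_lift a b w1 w2 \<theta>"
    and t: "t \<in> {a..b}" "w1 t = 0"
    and deriv: "(w1 has_real_derivative D) (at t within {a..b})" and pos: "D * w2 t > 0"
  shows "\<exists>\<delta>>0. \<forall>s\<in>{a..b}. (t < s \<longrightarrow> s < t + \<delta> \<longrightarrow> \<theta> t < \<theta> s) \<and>
           (t - \<delta> < s \<longrightarrow> s < t \<longrightarrow> \<theta> s < \<theta> t)"
proof -
  let ?c = "cos (\<theta> t)"
  obtain R where R: "R > 0" "w2 t = R * ?c" "w1 t = R * sin (\<theta> t)"
    using lift t(1) unfolding polar_lift_def by blast
  then have st: "sin (\<theta> t) = 0" using t(2) by simp
  have "R * (?c * D) > 0" using pos R(2) by (simp add: mult_ac)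
  then have "?c * D > 0" using R(1) zero_less_mult_pos by blast
  moreover have dc: "((\<lambda>s. ?c * w1 s) has_real_derivative ?c * D) (at t within {a..b})"
    using deriv by (rule DERIV_cmult)
  ultimately obtain d1 d2 where d1: "d1 > 0"
      "\<And>h. \<lbrakk>h > 0; t + h \<in> {a..b}; h < d1\<rbrakk> \<Longrightarrow> ?c * w1 t < ?c * w1 (t + h)"
    and d2: "d2 > 0"
      "\<And>h. \<lbrakk>h > 0; t - h \<in> {a..b}; h < d2\<rbrakk> \<Longrightarrow> ?c * w1 (t - h) < ?c * w1 t"
    using has_real_derivative_pos_inc_right[OF dc] has_real_derivative_pos_inc_left[OF dc] by blast
  have "\<exists>d>0. \<forall>s\<in>{a..b}. \<bar>s - t\<bar> < d \<longrightarrow> \<bar>\<theta> s - \<theta> t\<bar> < pi"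
    using lift t(1) pi_gt_zero unfolding polar_lift_def continuous_on_iff dist_real_def by blast
  then obtain d3 where d3: "d3 > 0" "\<And>s. \<lbrakk>s \<in> {a..b}; \<bar>s - t\<bar> < d3\<rbrakk> \<Longrightarrow> \<bar>\<theta> s - \<theta> t\<bar> < pi"
    by blast
  define \<delta> where "\<delta> = min d1 (min d2 d3)"
  have \<delta>: "\<delta> > 0" "\<delta> \<le> d1" "\<delta> \<le> d2" "\<delta> \<le> d3" using d1 d2 d3 by (auto simp: \<delta>_def)
  have sgn: "\<exists>R>0. ?c * w1 s = R * sin (\<theta> s - \<theta> t)" if s: "s \<in> {a..b}" for s
  proof -
    obtain R where "R > 0" "w1 s = R * sin (\<theta> s)" using lift s unfolding polar_lift_def by blast
    moreover have "sin (\<theta> s - \<theta> t) = sin (\<theta> s) * ?c" using st by (simp add: sin_diff)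
    ultimately have "?c * w1 s = R * sin (\<theta> s - \<theta> t)" by (simp only: mult_ac)
    then show ?thesis using \<open>R > 0\<close> by blast
  qed
  have "\<theta> t < \<theta> s" if s: "s \<in> {a..b}" "t < s" "s < t + \<delta>" for s
  proof (rule ccontr)
    assume "\<not> \<theta> t < \<theta> s"
    moreover have "\<bar>\<theta> s - \<theta> t\<bar> < pi" using d3(2)[of s] s \<delta> by linarith
    ultimately have "sin (\<theta> t - \<theta> s) \<ge> 0" by (intro sin_ge_zero) linarith+
    then have "sin (\<theta> s - \<theta> t) \<le> 0" using sin_minus[of "\<theta> s - \<theta> t"] by simp
    moreover obtain R where "R > 0" "?c * w1 s = R * sin (\<theta> s - \<theta> t)" using sgn s by blast
    ultimately have "?c * w1 s \<le> 0" by (simp add: mult_nonneg_nonpos)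
    moreover have "?c * w1 t < ?c * w1 (t + (s - t))" by (rule d1(2)) (use s \<delta> in auto)
    ultimately show False using t(2) by simp
  qed
  moreover have "\<theta> s < \<theta> t" if s: "s \<in> {a..b}" "t - \<delta> < s" "s < t" for s
  proof (rule ccontr)
    assume "\<not> \<theta> s < \<theta> t"
    moreover have "\<bar>\<theta> s - \<theta> t\<bar> < pi" using d3(2)[of s] s \<delta> by linarith
    ultimately have "sin (\<theta> s - \<theta> t) \<ge> 0" by (intro sin_ge_zero) linarith+
    moreover obtain R where "R > 0" "?c * w1 s = R * sin (\<theta> s - \<theta> t)" using sgn s by blast
    ultimately have "?c * w1 s \<ge> 0" by simp
    moreover have "?c * w1 (t - (t - s)) < ?c * w1 t" by (rule d2(2)) (use s \<delta> in auto)
    ultimately show False using t(2) by simp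
  qed
  ultimately show ?thesis using \<delta>(1) by blast
qed

text \<open>
  Since all crossings are upwards, the angle meets every multiple of \<open>\<pi>\<close> at most once, and
  \<open>t \<mapsto> \<lfloor>\<theta> t / \<pi>\<rfloor>\<close> is a bijection from the zeros to the integers that the index counts. A zero at
  \<open>a\<close> is left out because \<open>\<lfloor>\<theta> a / \<pi>\<rfloor>\<close> already includes it, while a zero at \<open>b\<close> counts.
\<close>

lemma maslov_ind_eq_card_zeros:
  assumes "a \<le> b" and lift: "polar_lift a b w1 w2 \<theta>"
    and deriv: "\<And>t. \<lbrakk>t \<in> {a..b}; w1 t = 0\<rbrakk> \<Longrightarrow>
       \<exists>D. (w1 has_real_derivative D) (at t within {a..b}) \<and> D * w2 t > 0"
  shows "finite {t \<in> {a<..b}. w1 t = 0}"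
    and "maslov_ind a b w1 w2 = int (card {t \<in> {a<..b}. w1 t = 0})"
proof -
  let ?Z = "{t \<in> {a<..b}. w1 t = 0}" and ?K = "{\<lfloor>\<theta> a / pi\<rfloor> <.. \<lfloor>\<theta> b / pi\<rfloor>}"
  have cont: "continuous_on {a..b} \<theta>" using lift unfolding polar_lift_def by blast
  have up: "\<exists>\<delta>>0. \<forall>s\<in>{a..b}. (t < s \<longrightarrow> s < t + \<delta> \<longrightarrow> of_int k * pi < \<theta> s) \<and>
           (t - \<delta> < s \<longrightarrow> s < t \<longrightarrow> \<theta> s < of_int k * pi)"
    if "t \<in> {a..b}" "\<theta> t = of_int k * pi" for t k
  proof -
    have "w1 t = 0" using polar_lift_zero_iff[OF lift] that by blast
    with deriv that show ?thesis using polar_lift_upcrossing[OF lift, of t] by metis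
  qed
  note above = upcrossing_stays_above[OF cont up]
  note below = upcrossing_stays_below[OF cont up]
  have lvl: "\<theta> t = of_int \<lfloor>\<theta> t / pi\<rfloor> * pi" if "t \<in> ?Z" for t
    using polar_lift_zero_iff[OF lift, of t] that by auto
  have "bij_betw (\<lambda>t. \<lfloor>\<theta> t / pi\<rfloor>) ?Z ?K"
  proof (rule bij_betw_imageI)
    show "inj_on (\<lambda>t. \<lfloor>\<theta> t / pi\<rfloor>) ?Z"
    proof (rule linorder_inj_onI)
      fix s t assume st: "s < t" "s \<in> ?Z" "t \<in> ?Z"
      then show "\<lfloor>\<theta> s / pi\<rfloor> \<noteq> \<lfloor>\<theta> t / pi\<rfloor>"
        using above[where t = s and s = t, OF _ _ _ lvl] lvl[of t] by auto
    qed auto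
    show "(\<lambda>t. \<lfloor>\<theta> t / pi\<rfloor>) ` ?Z = ?K"
    proof (intro equalityI subsetI)
      fix k assume "k \<in> (\<lambda>t. \<lfloor>\<theta> t / pi\<rfloor>) ` ?Z"
      then obtain t where t: "t \<in> ?Z" "\<theta> t = of_int k * pi" using lvl by auto
      have "\<theta> a < of_int k * pi" using below[where t = t and s = a, OF _ _ _ t(2)] t by auto
      moreover have "of_int k * pi \<le> \<theta> b"
        using above[where t = t and s = b, OF _ _ _ t(2)] t by (cases "t = b") auto
      ultimately show "k \<in> ?K"
        using of_int_times_pi_le_iff[of k "\<theta> a"] of_int_times_pi_le_iff[of k "\<theta> b"] by auto
    next
      fix k assume "k \<in> ?K"
      then have k: "\<theta> a < of_int k * pi" "of_int k * pi \<le> \<theta> b"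
        using of_int_times_pi_le_iff[of k "\<theta> a"] of_int_times_pi_le_iff[of k "\<theta> b"] by auto
      then obtain t where t: "a \<le> t" "t \<le> b" "\<theta> t = of_int k * pi"
        using IVT'[of \<theta> a "of_int k * pi" b] cont \<open>a \<le> b\<close> by auto
      moreover have "a \<noteq> t" using k t by auto
      ultimately have "t \<in> ?Z" using polar_lift_zero_iff[OF lift, of t] by auto
      then show "k \<in> (\<lambda>t. \<lfloor>\<theta> t / pi\<rfloor>) ` ?Z" using t by (intro image_eqI[of _ _ t]) auto
    qed
  qed
  then have "finite ?Z" "card ?Z = card ?K"
    using bij_betw_finite[of "\<lambda>t. \<lfloor>\<theta> t / pi\<rfloor>" ?Z ?K] bij_betw_same_card[of "\<lambda>t. \<lfloor>\<theta> t / pi\<rfloor>" ?Z ?K]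
    by simp_all
  \<comment> \<open>Otherwise \<open>?K\<close> would be empty, and its cardinality would be \<open>0\<close> instead of the negative
    difference.\<close>
  moreover have "\<lfloor>\<theta> a / pi\<rfloor> \<le> \<lfloor>\<theta> b / pi\<rfloor>"
  proof (rule ccontr)
    assume neg: "\<not> ?thesis"
    let ?k = "\<lfloor>\<theta> a / pi\<rfloor>"
    have "of_int ?k * pi \<le> \<theta> a" "\<theta> b < of_int ?k * pi"
      using of_int_times_pi_le_iff[of ?k "\<theta> a"] of_int_times_pi_le_iff[of ?k "\<theta> b"] neg by auto
    then obtain t where t: "a \<le> t" "t \<le> b" "\<theta> t = of_int ?k * pi"
      using IVT2'[of \<theta> b "of_int ?k * pi" a] cont \<open>a \<le> b\<close> by auto
    with above[where t = t and s = b, OF _ _ _ t(3)] \<open>\<theta> b < of_int ?k * pi\<close>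
    show False by (cases "t = b") auto
  qed
  ultimately show "finite ?Z" "maslov_ind a b w1 w2 = int (card ?Z)"
    using maslov_ind_eq[OF \<open>a \<le> b\<close> lift] by auto
qed

section \<open>Linear differential equations\<close>

text \<open>
  The function \<open>exp (- K (x - a)) u x - e (x - a)\<close> is nonincreasing on \<open>[a, b]\<close>.
\<close>

lemma gronwall_unit_interval:
  fixes u u' :: "real \<Rightarrow> real"
  assumes deriv: "\<And>x. x \<in> {0..1} \<Longrightarrow> (u has_real_derivative u' x) (at x within {0..1})"
    and le: "\<And>x. x \<in> {0..1} \<Longrightarrow> u' x \<le> K * u x + e"
    and "0 \<le> K" "0 \<le> e" and ab: "0 \<le> a" "a \<le> b" "b \<le> 1"
  shows "u b \<le> exp (K * (b - a)) * (u a + e * (b - a))"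
proof -
  let ?v = "\<lambda>x. exp (- K * (x - a)) * u x - e * (x - a)"
  let ?v' = "\<lambda>x. exp (- K * (x - a)) * (u' x - K * u x) - e"
  have D: "(?v has_real_derivative ?v' x) (at x within {0..1})" if "x \<in> {0..1}" for x
    by (rule derivative_eq_intros deriv that refl | simp add: algebra_simps)+
  have "?v b \<le> ?v a"
  proof (rule DERIV_nonpos_imp_decreasing_open[where f = ?v])
    show "\<exists>y. (?v has_real_derivative y) (at x) \<and> y \<le> 0" if x: "a < x" "x < b" for x
    proof (intro exI[of _ "?v' x"] conjI)
      have "x \<in> interior {0..1}" using x ab by simp
      then have "at x within {0..1} = at x" by (rule at_within_interior)
      then show "(?v has_real_derivative ?v' x) (at x)" using D[of x] x ab by simp
      have "exp (- K * (x - a)) * (u' x - K * u x) \<le> exp (- K * (x - a)) * e"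
        using le[of x] x ab by (intro mult_left_mono) auto
      also have "\<dots> \<le> 1 * e"
        using x \<open>0 \<le> K\<close> \<open>0 \<le> e\<close> by (intro mult_right_mono) (auto simp: mult_nonneg_nonneg)
      finally show "?v' x \<le> 0" by simp
    qed
    have "continuous_on {0..1} ?v"
      unfolding continuous_on_eq_continuous_within using D DERIV_continuous by blast
    then show "continuous_on {a..b} ?v" by (rule continuous_on_subset) (use ab in auto)
  qed (use ab in auto)
  then have "exp (- K * (b - a)) * u b \<le> u a + e * (b - a)" by simp
  then have "exp (K * (b - a)) * (exp (- K * (b - a)) * u b) \<le> exp (K * (b - a)) * (u a + e * (b - a))"
    by (intro mult_left_mono) auto
  then show ?thesis by (simp add: mult.assoc[symmetric] exp_add[symmetric])
qed

lemma has_real_derivative_inner_self: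
  assumes "(y has_vector_derivative y') (at x within S)"
  shows "((\<lambda>x. y x \<bullet> y x) has_real_derivative 2 * (y x \<bullet> y')) (at x within S)"
  using bounded_bilinear.has_vector_derivative[OF bounded_bilinear_inner assms assms]
  by (simp add: has_real_derivative_iff_has_vector_derivative inner_commute)

text \<open>
  Uniqueness for linear equations, in a form that serves both for vector solutions and for the
  scalar function \<open>\<omega>1\<close> along the side \<open>\<lambda> = \<lambda>2\<close>. Gronwall's estimate for \<open>\<parallel>y\<parallel>\<^sup>2\<close> handles points
  to the right of \<open>x0\<close>; reflecting the interval handles those to the left.
\<close>

lemma linear_growth_zero_everywhere:
  fixes y y' :: "real \<Rightarrow> 'a::real_inner"
  assumes deriv: "\<And>x. x \<in> {0..1} \<Longrightarrow> (y has_vector_derivative y' x) (at x within {0..1})"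
    and bound: "\<And>x. x \<in> {0..1} \<Longrightarrow> norm (y' x) \<le> K * norm (y x)"
    and x0: "x0 \<in> {0..1}" "y x0 = 0" and x: "x \<in> {0..1}"
  shows "y x = 0"
proof -
  have forward: "z b = 0"
    if d: "\<And>x. x \<in> {0..1} \<Longrightarrow> (z has_vector_derivative z' x) (at x within {0..1})"
    and bd: "\<And>x. x \<in> {0..1} \<Longrightarrow> norm (z' x) \<le> K * norm (z x)"
    and ab: "0 \<le> a" "a \<le> b" "b \<le> 1" "z a = 0" for z z' :: "real \<Rightarrow> 'a" and a b
  proof -
    have "z b \<bullet> z b \<le> exp (2 * \<bar>K\<bar> * (b - a)) * (z a \<bullet> z a + 0 * (b - a))"
    proof (rule gronwall_unit_interval)
      show "2 * (z x \<bullet> z' x) \<le> 2 * \<bar>K\<bar> * (z x \<bullet> z x) + 0" if "x \<in> {0..1}" for x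
      proof -
        have "z x \<bullet> z' x \<le> norm (z x) * norm (z' x)" by (rule norm_cauchy_schwarz)
        also have "\<dots> \<le> norm (z x) * (\<bar>K\<bar> * norm (z x))"
          using bd[OF that] by (intro mult_left_mono order_trans[OF bd[OF that]] mult_right_mono) auto
        finally show ?thesis by (simp add: dot_square_norm power2_eq_square mult_ac)
      qed
      show "((\<lambda>x. z x \<bullet> z x) has_real_derivative 2 * (z x \<bullet> z' x)) (at x within {0..1})"
        if "x \<in> {0..1}" for x
        using d[OF that] by (rule has_real_derivative_inner_self)
    qed (use ab in auto)
    with \<open>z a = 0\<close> have "z b \<bullet> z b \<le> 0" by simp
    then show ?thesis using inner_ge_zero[of "z b"] inner_eq_zero_iff[of "z b"] by linarith
  qed
  show ?thesis
  proof (cases "x0 \<le> x")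
    case True
    then show ?thesis using forward[of y y' x0 x] deriv bound x0 x by auto
  next
    case False
    have "((\<lambda>t. y (1 - t)) has_vector_derivative - y' (1 - t)) (at t within {0..1})" if t: "t \<in> {0..1}" for t
    proof -
      have "((y \<circ> (\<lambda>t. 1 - t)) has_vector_derivative (- 1) *\<^sub>R y' (1 - t)) (at t within {0..1})"
      proof (rule vector_diff_chain_within)
        have "(\<lambda>t. 1 - t) ` {0..1::real} = {0..1}" by (auto simp: image_iff intro!: bexI[of _ "1 - _"])
        then show "(y has_vector_derivative y' (1 - t)) (at (1 - t) within (\<lambda>t. 1 - t) ` {0..1})"
          using deriv[of "1 - t"] t by simp
      qed (auto intro!: derivative_eq_intros)
      then show ?thesis by (simp add: o_def)
    qed
    then have "y (1 - (1 - x)) = 0"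
      using bound x0 x False by (intro forward[of "\<lambda>t. y (1 - t)" "\<lambda>t. - y' (1 - t)" "1 - x0" "1 - x"]) auto
    then show ?thesis by simp
  qed
qed

lemma bounded_bilinear_matrix_vector_mult:
  "bounded_bilinear (\<lambda>(M :: real^'c^'r) v. M *v v)"
  unfolding bilinear_conv_bounded_bilinear[symmetric] bilinear_def
  by (auto intro!: linearI simp: matrix_vector_mult_add_rdistrib scaleR_matrix_vector_assoc)

lemma solves_odeD:
  assumes "solves_ode A l1 l2 X" "l \<in> {l1..l2}" "x \<in> {0..1}"
  shows "((\<lambda>x. X x l *v c) has_vector_derivative A x l *v (X x l *v c)) (at x within {0..1})"
proof -
  have "((\<lambda>x. X x l) has_vector_derivative A x l ** X x l) (at x within {0..1})"
    using assms unfolding solves_ode_def by blast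
  from bounded_linear.has_vector_derivative[OF
      bounded_bilinear.bounded_linear_left[OF bounded_bilinear_matrix_vector_mult] this]
  show ?thesis by (simp add: matrix_vector_mul_assoc)
qed

lemma assumption_A_bounds:
  fixes A :: "real \<Rightarrow> real \<Rightarrow> real^'n^'n"
  assumes "assumption_A A l1 l2"
  obtains M where "0 \<le> M" "\<And>x l v. \<lbrakk>x \<in> {0..1}; l \<in> {l1..l2}\<rbrakk> \<Longrightarrow> norm (A x l *v v) \<le> M * norm v"
proof -
  obtain K where K: "K > 0" "\<And>B v. norm ((B :: real^'n^'n) *v v) \<le> norm B * norm v * K"
    using bounded_bilinear.pos_bounded[OF bounded_bilinear_matrix_vector_mult] by blast
  have "compact ((\<lambda>(x, l). A x l) ` ({0..1} \<times> {l1..l2}))"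
    using assms unfolding assumption_A_def
    by (intro compact_continuous_image compact_Times) auto
  then obtain C where "C > 0" and "\<forall>B\<in>(\<lambda>(x, l). A x l) ` ({0..1} \<times> {l1..l2}). norm B \<le> C"
    using compact_imp_bounded bounded_pos by blast
  then have C: "C > 0" "\<And>(x::real) (l::real). \<lbrakk>x \<in> {0..1}; l \<in> {l1..l2}\<rbrakk> \<Longrightarrow> norm (A x l) \<le> C"
    by auto
  show ?thesis
  proof (rule that[of "C * K"])
    fix x l :: real and v assume xl: "x \<in> {0..1}" "l \<in> {l1..l2}"
    have "norm (A x l *v v) \<le> norm (A x l) * (norm v * K)" using K(2)[of "A x l" v] by simp
    also have "\<dots> \<le> C * (norm v * K)" using C(2)[OF xl] K by (intro mult_right_mono) auto
    finally show "norm (A x l *v v) \<le> C * K * norm v" by (simp add: mult_ac)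
  qed (use C K in auto)
qed

text \<open>
  The difference \<open>D\<close> of the solutions for \<open>\<lambda>\<close> and \<open>\<mu>\<close> solves the equation for \<open>\<lambda>\<close> with the
  inhomogeneity \<open>(A(x, \<lambda>) - A(x, \<mu>)) y\<^sub>\<mu>(x)\<close>, and \<open>D 0 = 0\<close>. The inhomogeneity is uniformly
  small by uniform continuity of \<open>A\<close>, so Gronwall's estimate bounds \<open>D 1\<close>.
\<close>

lemma continuous_on_parameter:
  fixes A :: "real \<Rightarrow> real \<Rightarrow> real^'n^'n"
  assumes A: "assumption_A A l1 l2" and X: "solves_ode A l1 l2 X"
    and init: "\<forall>l\<in>{l1..l2}. X 0 l = P"
  shows "continuous_on {l1..l2} (\<lambda>l. X 1 l *v c)"
  unfolding continuous_on_iff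
proof (intro ballI allI impI)
  fix \<mu> and \<epsilon> :: real assume \<mu>: "\<mu> \<in> {l1..l2}" and "0 < \<epsilon>"
  obtain M where M: "0 \<le> M" "\<And>x l v. \<lbrakk>x \<in> {0..1}; l \<in> {l1..l2}\<rbrakk> \<Longrightarrow> norm (A x l *v v) \<le> M * norm v"
    using assumption_A_bounds[OF A] by blast
  obtain K where K: "K > 0" "\<And>B v. norm ((B :: real^'n^'n) *v v) \<le> norm B * norm v * K"
    using bounded_bilinear.pos_bounded[OF bounded_bilinear_matrix_vector_mult] by blast
  have "continuous_on {0..1} (\<lambda>x. X x \<mu> *v c)"
    unfolding continuous_on_eq_continuous_within
    using solves_odeD[OF X \<mu>] has_vector_derivative_continuous by blast
  then have "compact ((\<lambda>x. X x \<mu> *v c) ` {0..1})" by (intro compact_continuous_image) auto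
  then obtain C where "C > 0" and "\<forall>v\<in>(\<lambda>x. X x \<mu> *v c) ` {0..1}. norm v \<le> C"
    using compact_imp_bounded bounded_pos by blast
  then have C: "C > 0" "\<And>x. x \<in> {0..1} \<Longrightarrow> norm (X x \<mu> *v c) \<le> C" by auto
  \<comment> \<open>The estimate below is \<open>\<parallel>D 1\<parallel>\<^sup>2 \<le> E (\<eta> C K)\<^sup>2\<close>; bounding \<open>E\<close> by \<open>E\<^sup>2\<close> makes the right-hand
    side a square, and \<open>\<eta>\<close> is chosen to make its root smaller than \<open>\<epsilon>\<close>.\<close>
  define E where "E = exp (2 * M + 1)"
  define \<eta> where "\<eta> = \<epsilon> / (E * (C * K) + 1)"
  have "E \<ge> 1" using M(1) by (simp add: E_def)
  have "E * (C * K) + 1 > 0" using \<open>E \<ge> 1\<close> C K by (simp add: add_pos_pos)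
  then have \<eta>: "\<eta> > 0" "E * (\<eta> * (C * K)) < \<epsilon>"
    using \<open>0 < \<epsilon>\<close> by (simp_all add: \<eta>_def field_simps)
  have "uniformly_continuous_on ({0..1} \<times> {l1..l2}) (\<lambda>(x, l). A x l)"
    using A unfolding assumption_A_def by (intro compact_uniformly_continuous compact_Times) auto
  then obtain \<delta> where \<delta>: "\<delta> > 0" and unif: "\<And>p p'. \<lbrakk>p \<in> {0..1} \<times> {l1..l2}; p' \<in> {0..1} \<times> {l1..l2};
      dist p' p < \<delta>\<rbrakk> \<Longrightarrow> dist ((\<lambda>(x, l). A x l) p') ((\<lambda>(x, l). A x l) p) < \<eta>"
    using \<open>\<eta> > 0\<close> unfolding uniformly_continuous_on_def by (elim allE[of _ \<eta>]) auto
  show "\<exists>d>0. \<forall>l\<in>{l1..l2}. dist l \<mu> < d \<longrightarrow> dist (X 1 l *v c) (X 1 \<mu> *v c) < \<epsilon>"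
  proof (intro exI[of _ \<delta>] conjI ballI impI)
    fix l assume l: "l \<in> {l1..l2}" and "dist l \<mu> < \<delta>"
    have close: "norm (A x l - A x \<mu>) \<le> \<eta>" if "x \<in> {0..1}" for x
      using unif[of "(x, \<mu>)" "(x, l)"] that l \<mu> \<open>dist l \<mu> < \<delta>\<close> by (simp add: dist_Pair_Pair dist_norm)
    let ?D = "\<lambda>x. X x l *v c - X x \<mu> *v c"
    let ?D' = "\<lambda>x. A x l *v ?D x + (A x l - A x \<mu>) *v (X x \<mu> *v c)"
    have "?D 1 \<bullet> ?D 1 \<le> exp ((2 * M + 1) * (1 - 0)) * (?D 0 \<bullet> ?D 0 + (\<eta> * C * K)\<^sup>2 * (1 - 0))"
    proof (rule gronwall_unit_interval)
      fix x :: real assume x: "x \<in> {0..1}"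
      have "(?D has_vector_derivative ?D' x) (at x within {0..1})"
        using has_vector_derivative_diff[OF solves_odeD[OF X l x] solves_odeD[OF X \<mu> x]]
        by (simp add: matrix_vector_mult_diff_distrib matrix_vector_mult_diff_rdistrib)
      then show "((\<lambda>x. ?D x \<bullet> ?D x) has_real_derivative 2 * (?D x \<bullet> ?D' x)) (at x within {0..1})"
        by (rule has_real_derivative_inner_self)
      have "?D x \<bullet> ?D' x \<le> norm (?D x) * (norm (A x l *v ?D x) + norm ((A x l - A x \<mu>) *v (X x \<mu> *v c)))"
        by (rule order_trans[OF norm_cauchy_schwarz]) (intro mult_left_mono norm_triangle_ineq norm_ge_zero)
      also have "\<dots> \<le> norm (?D x) * (M * norm (?D x) + \<eta> * C * K)"
      proof (intro mult_left_mono add_mono M(2) x l norm_ge_zero)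
        show "norm ((A x l - A x \<mu>) *v (X x \<mu> *v c)) \<le> \<eta> * C * K"
          using close[OF x] C(2)[OF x] K(1) \<open>\<eta> > 0\<close>
          by (intro order_trans[OF K(2)] mult_right_mono mult_mono) auto
      qed
      finally have "2 * (?D x \<bullet> ?D' x) \<le> 2 * (norm (?D x) * (M * norm (?D x) + \<eta> * C * K))"
        by simp
      also have "\<dots> \<le> (2 * M + 1) * (norm (?D x))\<^sup>2 + (\<eta> * C * K)\<^sup>2"
        using sum_squares_bound[of "norm (?D x)" "\<eta> * C * K"] by (simp add: power2_eq_square algebra_simps)
      finally show "2 * (?D x \<bullet> ?D' x) \<le> (2 * M + 1) * (?D x \<bullet> ?D x) + (\<eta> * C * K)\<^sup>2"
        by (simp add: dot_square_norm)
    qed (use M in auto)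
    also have "\<dots> = E * (\<eta> * C * K)\<^sup>2" using init l \<mu> by (simp add: E_def)
    also have "\<dots> \<le> E\<^sup>2 * (\<eta> * C * K)\<^sup>2"
      using \<open>E \<ge> 1\<close> by (intro mult_right_mono) (simp_all add: power2_eq_square)
    finally have "(norm (?D 1))\<^sup>2 \<le> (E * (\<eta> * (C * K)))\<^sup>2"
      by (simp only: dot_square_norm power_mult_distrib mult.assoc)
    then have "norm (?D 1) \<le> E * (\<eta> * (C * K))"
      using \<open>E \<ge> 1\<close> \<open>\<eta> > 0\<close> C(1) K(1) by - (rule power2_le_imp_le, simp_all)
    then show "dist (X 1 l *v c) (X 1 \<mu> *v c) < \<epsilon>" using \<eta>(2) by (simp add: dist_norm)
  qed (rule \<delta>)
qed

lemma is_frame_mult_eq_0: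
  assumes "is_frame M V" "M *v c = 0"
  shows "c = 0"
proof -
  let ?col = "\<lambda>j. column j M"
  have inj: "inj ?col" and ind: "independent (range ?col)"
    using assms(1) unfolding is_frame_def columns_def by (auto simp: full_SetCompr_eq)
  have "(\<Sum>v\<in>range ?col. c $ inv ?col v *\<^sub>R v) = (\<Sum>j\<in>UNIV. c $ j *\<^sub>R column j M)"
    by (subst sum.reindex[OF inj]) (simp add: inv_f_f[OF inj])
  also have "\<dots> = 0" using assms(2) by (simp add: matrix_mult_sum scalar_mult_eq_scaleR)
  finally have "c $ inv ?col (column j M) = 0" for j
    by (intro independentD[OF ind _ _ _ rangeI]) auto
  then show ?thesis by (simp add: inv_f_f[OF inj] vec_eq_iff)
qed

text \<open>
  A combination of the columns that vanishes at one point vanishes at all points, also at the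
  point where the columns are known to be independent.
\<close>

lemma solution_frame_mult_eq_0:
  assumes A: "assumption_A A l1 l2" and X: "solves_ode A l1 l2 X" and l: "l \<in> {l1..l2}"
    and x0: "x0 \<in> {0..1}" "is_frame (X x0 l) V" and x: "x \<in> {0..1}" "X x l *v c = 0"
  shows "c = 0"
proof -
  obtain M where M: "0 \<le> M" "\<And>x l v. \<lbrakk>x \<in> {0..1}; l \<in> {l1..l2}\<rbrakk> \<Longrightarrow> norm (A x l *v v) \<le> M * norm v"
    using assumption_A_bounds[OF A] by blast
  have "X x0 l *v c = 0"
    by (rule linear_growth_zero_everywhere[OF solves_odeD[OF X l] M(2)[OF _ l] x x0(1)])
  then show ?thesis by (rule is_frame_mult_eq_0[OF x0(2)])
qed

section \<open>The frame of solutions and the zeros of its determinant\<close>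

lemma column_F_frame:
  "column j (F_frame G H l2 x l) = (case j of Inl c \<Rightarrow> embed_upper (G x l *v axis c 1)
     | Inr d \<Rightarrow> embed_lower (H x l2 *v axis d 1))"
  by (auto simp: vec_eq_iff F_frame_def column_def embed_upper_def embed_lower_def vcat_def hcat_def
      matrix_vector_mult_basis split: sum.splits)

lemma bounded_linear_embed_upper: "bounded_linear embed_upper" and bounded_linear_embed_lower: "bounded_linear embed_lower"
  by (auto intro!: linearI simp: linear_conv_bounded_linear[symmetric] vec_eq_iff embed_upper_def embed_lower_def split: sum.splits)

text \<open>
  In the kernel of \<open>(F Delta_tilde)\<close>, the lower half of the vector must equal \<open>G c\<close> by the upper
  block row and \<open>- H d\<close> by the lower one, so kernel vectors correspond to pairs with
  \<open>G c = - H d\<close>.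
\<close>

lemma omega1_eq_0_iff:
  "omega1 (\<lambda>j. column j (F_frame G H l2 x l)) = 0 \<longleftrightarrow>
     (\<exists>c d. (c, d) \<noteq> (0, 0) \<and> G x l *v c + H x l2 *v d = 0)"
proof -
  define X where "X = hcat (F_frame G H l2 x l) Delta_tilde"
  have "(\<chi> i j. column j (F_frame G H l2 x l) $ i) = F_frame G H l2 x l"
    by (simp add: vec_eq_iff column_def)
  then have "omega1 (\<lambda>j. column j (F_frame G H l2 x l)) = det X"
    by (simp add: omega1_def X_def)
  moreover have "det X = 0 \<longleftrightarrow> (\<exists>z. z \<noteq> 0 \<and> X *v z = 0)"
    using invertible_det_nz[of X] matrix_left_invertible_ker[of X] invertible_left_inverse[of X] by blast
  moreover have "(\<exists>z. z \<noteq> 0 \<and> X *v z = 0) \<longleftrightarrow>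
     (\<exists>c d. (c, d) \<noteq> (0, 0) \<and> G x l *v c + H x l2 *v d = 0)"
  proof -
    have top: "(X *v z) $ Inl i = (G x l *v (\<chi> a. z $ Inl (Inl a))) $ i - z $ Inr i"
     and bot: "(X *v z) $ Inr i = (H x l2 *v (\<chi> a. z $ Inl (Inr a))) $ i + z $ Inr i" for z i
      by (cases i; simp add: X_def matrix_vector_mult_def sum_Plus_UNIV
          F_frame_def vcat_def hcat_def Delta_tilde_def mat_def if_distrib[of "\<lambda>x. _ * x"]
          if_distrib[of "\<lambda>x. x * _"] sum_negf cong: if_cong)+
    show ?thesis
    proof
      assume "\<exists>z. z \<noteq> 0 \<and> X *v z = 0"
      then obtain z where z: "z \<noteq> 0" "X *v z = 0" by blast
      let ?c = "\<chi> a. z $ Inl (Inl a)" and ?d = "\<chi> a. z $ Inl (Inr a)"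
      have t: "(G x l *v ?c) $ i = z $ Inr i" and b: "(H x l2 *v ?d) $ i = - z $ Inr i" for i
        using top[of z i] bot[of z i] z by simp_all
      then have "G x l *v ?c + H x l2 *v ?d = 0" by (simp add: vec_eq_iff)
      moreover have "(?c, ?d) \<noteq> (0, 0)"
      proof
        assume 0: "(?c, ?d) = (0, 0)"
        then have "z $ Inr i = 0" for i using t[of i] by simp
        moreover have "z $ Inl i = 0" for i using 0 by (cases i) (auto simp: vec_eq_iff)
        ultimately have "z $ i = 0" for i by (cases i) auto
        then show False using z by (simp add: vec_eq_iff)
      qed
      ultimately show "\<exists>c d. (c, d) \<noteq> (0, 0) \<and> G x l *v c + H x l2 *v d = 0" by blast
    next
      assume "\<exists>c d. (c, d) \<noteq> (0, 0) \<and> G x l *v c + H x l2 *v d = 0"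
      then obtain c d where cd: "(c, d) \<noteq> (0, 0)" "G x l *v c + H x l2 *v d = 0" by blast
      define z where "z = (\<chi> i. case i of Inl (Inl a) \<Rightarrow> c $ a | Inl (Inr b) \<Rightarrow> d $ b
          | Inr i \<Rightarrow> (G x l *v c) $ i)"
      have z1: "(\<chi> a. z $ Inl (Inl a)) = c" "(\<chi> a. z $ Inl (Inr a)) = d"
          and z2: "z $ Inr i = (G x l *v c) $ i" for i
        by (simp_all add: z_def vec_eq_iff)
      have "(X *v z) $ i = 0" for i
      proof (cases i)
        case (Inl a) then show ?thesis using top[of z a] by (simp add: z1 z2)
      next
        case (Inr a)
        moreover have "(G x l *v c + H x l2 *v d) $ a = 0" using cd by simp
        ultimately show ?thesis using bot[of z a] by (simp add: z1 z2)
      qed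
      moreover have "z \<noteq> 0" using z1 cd by (auto simp: zero_vec_def)
      ultimately show "\<exists>z. z \<noteq> 0 \<and> X *v z = 0" by (auto simp: vec_eq_iff)
    qed
  qed
  ultimately show ?thesis by simp
qed

lemma col_space_eq_range: "col_space M = range ((*v) M)"
proof
  have "subspace (range ((*v) M))"
    by (intro linear_subspace_image matrix_vector_mul_linear subspace_UNIV)
  moreover have "columns M \<subseteq> range ((*v) M)"
    by (auto simp: columns_def matrix_vector_mult_basis[symmetric])
  ultimately show "col_space M \<subseteq> range ((*v) M)"
    unfolding col_space_def by (rule span_minimal[rotated])
  show "range ((*v) M) \<subseteq> col_space M"
    unfolding col_space_def using matrix_vector_mult_in_columnspace by blast
qed

text \<open>
  Independence of the columns on both sides turns a nontrivial relation \<open>G c + H d = 0\<close> into a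
  nonzero common vector \<open>G c\<close>.
\<close>

lemma omega_along_omega1_eq_0_iff_intersect:
  assumes "\<And>c. G x l *v c = 0 \<Longrightarrow> c = 0" "\<And>d. H x l2 *v d = 0 \<Longrightarrow> d = 0"
  shows "omega_along omega1 (F_frame G H l2) x l = 0
    \<longleftrightarrow> col_space (G x l) \<inter> col_space (H x l2) \<noteq> {0}"
proof -
  have "0 \<in> col_space (G x l) \<inter> col_space (H x l2)"
    by (simp add: col_space_def span_zero)
  then have "col_space (G x l) \<inter> col_space (H x l2) \<noteq> {0}
      \<longleftrightarrow> (\<exists>c d. G x l *v c = H x l2 *v d \<and> G x l *v c \<noteq> 0)"
    unfolding col_space_eq_range by (auto; metis rangeI)
  also have "\<dots> \<longleftrightarrow> (\<exists>c d. (c, d) \<noteq> (0, 0) \<and> G x l *v c + H x l2 *v d = 0)"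
  proof (intro iffI; elim exE conjE)
    fix c d assume "G x l *v c = H x l2 *v d" "G x l *v c \<noteq> 0"
    then have "(c, - d) \<noteq> (0, 0)" "G x l *v c + H x l2 *v (- d) = 0"
      by (auto simp: linear_neg[OF matrix_vector_mul_linear])
    then show "\<exists>c d. (c, d) \<noteq> (0, 0) \<and> G x l *v c + H x l2 *v d = 0" by blast
  next
    fix c d assume nz: "(c, d) \<noteq> (0, 0)" and sum: "G x l *v c + H x l2 *v d = 0"
    then have "G x l *v c = H x l2 *v (- d)"
      by (simp add: linear_neg[OF matrix_vector_mul_linear] eq_neg_iff_add_eq_0)
    moreover have "G x l *v c \<noteq> 0"
      using nz sum assms by (auto simp: add_eq_0_iff)
    ultimately show "\<exists>c d. G x l *v c = H x l2 *v d \<and> G x l *v c \<noteq> 0" by blast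
  qed
  finally show ?thesis by (simp add: omega_along_def omega1_eq_0_iff)
qed

text \<open>
  If \<open>G(1, \<lambda>) c + H(1) d = 0\<close>, then \<open>y = G(\<cdot>, \<lambda>) c\<close> is an eigenfunction: \<open>y 1 = - H(1) d\<close> lies
  in \<open>q\<close>, and \<open>y = 0\<close> would give \<open>c = 0\<close> at \<open>x = 0\<close> and then \<open>d = 0\<close> at \<open>x = 1\<close>.
\<close>

lemma is_eigenvalue_if_omega1_eq_0:
  assumes A: "assumption_A A l1 l2" and G: "solves_ode A l1 l2 G" and l: "l \<in> {l1..l2}"
    and P: "is_frame (G 0 l) p" and Q: "is_frame (H 1 l2) q"
    and zero: "omega_along omega1 (F_frame G H l2) 1 l = 0"
  shows "is_eigenvalue A p q l"
proof -
  obtain c d where cd: "(c, d) \<noteq> (0, 0)" "G 1 l *v c + H 1 l2 *v d = 0"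
    using zero unfolding omega_along_def omega1_eq_0_iff by blast
  let ?y = "\<lambda>x. G x l *v c"
  have D: "(?y has_vector_derivative A x l *v ?y x) (at x within {0..1})" if "x \<in> {0..1}" for x
    using solves_odeD[OF G l that] .
  have "continuous_on {0..1} (\<lambda>x. case (x, l) of (x, l) \<Rightarrow> A x l)"
    by (rule continuous_on_compose2[OF A[unfolded assumption_A_def]])
       (use l in \<open>auto intro!: continuous_intros\<close>)
  then have cA: "continuous_on {0..1} (\<lambda>x. A x l)" by simp
  have "continuous_on {0..1} ?y"
    unfolding continuous_on_eq_continuous_within using D has_vector_derivative_continuous by blast
  then have "continuous_on {0..1} (\<lambda>x. A x l *v ?y x)"
    by (rule bounded_bilinear.continuous_on[OF bounded_bilinear_matrix_vector_mult cA])
  moreover have "?y 0 \<in> p"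
    using P matrix_vector_mult_in_columnspace unfolding is_frame_def by blast
  moreover have "?y 1 = H 1 l2 *v (- d)"
    using cd(2) by (simp add: linear_neg[OF matrix_vector_mul_linear] eq_neg_iff_add_eq_0)
  then have "?y 1 \<in> q"
    using Q matrix_vector_mult_in_columnspace unfolding is_frame_def by metis
  moreover have "\<exists>x\<in>{0..1}. ?y x \<noteq> 0"
  proof (rule ccontr)
    assume "\<not> ?thesis"
    then have "?y 0 = 0" "?y 1 = 0" by auto
    then have "c = 0" "H 1 l2 *v d = 0" using is_frame_mult_eq_0[OF P] cd(2) by auto
    then show False using is_frame_mult_eq_0[OF Q] cd(1) by auto
  qed
  ultimately show ?thesis
    unfolding is_eigenvalue_def using D by (intro exI[of _ ?y] exI[of _ "\<lambda>x. A x l *v ?y x"]) auto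
qed

lemma continuous_on_column_F_frame_lambda:
  assumes "assumption_A A l1 l2" "solves_ode A l1 l2 G" "\<forall>l\<in>{l1..l2}. G 0 l = P"
  shows "continuous_on {l1..l2} (\<lambda>l. column j (F_frame G H l2 1 l))"
  unfolding column_F_frame
  by (cases j) (auto intro!: bounded_linear.continuous_on[OF bounded_linear_embed_upper]
      continuous_on_parameter[OF assms])

lemma continuous_on_omega_along_x:
  assumes "multilinear \<omega>" "\<And>j. continuous_on S (\<lambda>x. column j (F x l))"
  shows "continuous_on S (\<lambda>x. omega_along \<omega> F x l)"
  unfolding omega_along_def by (rule continuous_on_multilinear[OF assms])

lemma continuous_on_omega2_of:
  assumes "\<And>j. continuous_on S (\<lambda>x. column j (F x l))"
  shows "continuous_on S (\<lambda>x. omega_along (omega2_of M) F x l)"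
  unfolding omega_along_def omega2_of_def
proof (intro continuous_on_sum continuous_on_multilinear[OF multilinear_omega1])
  fix k j
  show "continuous_on S (\<lambda>x. ((\<lambda>j. column j (F x l))(k := M *v column k (F x l))) j)"
    using assms bounded_linear.continuous_on[OF matrix_vector_mul_bounded_linear assms]
    by (cases "j = k") simp_all
qed

section \<open>Evolution of the determinant in the space variable\<close>

lemma block_diag_embed_upper: "block_diag A B *v embed_upper u = embed_upper (A *v u)"
  and block_diag_embed_lower: "block_diag A B *v embed_lower u = embed_lower (B *v u)"
  by (auto simp: vec_eq_iff matrix_vector_mult_def sum_Plus_UNIV block_diag_def embed_upper_def embed_lower_def vcat_def hcat_def
      split: sum.splits)

lemma column_F_frame_has_derivative:
  assumes "solves_ode A l1 l2 G" "solves_ode A l1 l2 H" "l \<in> {l1..l2}" "l2 \<in> {l1..l2}" "x \<in> {0..1}"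
  shows "((\<lambda>x. column j (F_frame G H l2 x l)) has_vector_derivative
      block_diag (A x l) (A x l2) *v column j (F_frame G H l2 x l)) (at x within {0..1})"
proof (cases j)
  case (Inl c)
  show ?thesis
    unfolding column_F_frame Inl sum.case block_diag_embed_upper
    by (rule bounded_linear.has_vector_derivative[OF bounded_linear_embed_upper solves_odeD[OF assms(1,3,5)]])
next
  case (Inr d)
  show ?thesis
    unfolding column_F_frame Inr sum.case block_diag_embed_lower
    by (rule bounded_linear.has_vector_derivative[OF bounded_linear_embed_lower solves_odeD[OF assms(2,4,5)]])
qed

lemma continuous_on_column_F_frame_x:
  assumes "solves_ode A l1 l2 G" "solves_ode A l1 l2 H" "l \<in> {l1..l2}" "l2 \<in> {l1..l2}"
  shows "continuous_on {0..1} (\<lambda>x. column j (F_frame G H l2 x l))"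
  unfolding continuous_on_eq_continuous_within
  using column_F_frame_has_derivative[OF assms] has_vector_derivative_continuous by blast

lemma omega1_along_has_derivative:
  assumes "solves_ode A l1 l2 G" "solves_ode A l1 l2 H" "l \<in> {l1..l2}" "l2 \<in> {l1..l2}" "x \<in> {0..1}"
  shows "((\<lambda>x. omega_along omega1 (F_frame G H l2) x l) has_real_derivative
      omega_along (omega2_of (block_diag (A x l) (A x l2))) (F_frame G H l2) x l) (at x within {0..1})"
  unfolding omega_along_def omega2_of_def
  by (rule has_real_derivative_multilinear[OF multilinear_omega1 column_F_frame_has_derivative[OF assms]])

lemma abs_trace_le:
  fixes B :: "real^'n^'n" and M :: real
  assumes "\<And>v. norm (B *v v) \<le> M * norm v"
  shows "\<bar>trace B\<bar> \<le> CARD('n) * M"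
proof -
  have "\<bar>B $ i $ i\<bar> \<le> M" for i
  proof -
    have "\<bar>B $ i $ i\<bar> = \<bar>(B *v axis i 1) $ i\<bar>" by (simp add: matrix_vector_mult_basis column_def)
    also have "\<dots> \<le> M"
      using component_le_norm_cart[of "B *v axis i 1" i] assms[of "axis i 1"] by (simp add: norm_axis_1)
    finally show ?thesis .
  qed
  then have "(\<Sum>i\<in>UNIV. \<bar>B $ i $ i\<bar>) \<le> CARD('n) * M"
    using sum_bounded_above[of UNIV "\<lambda>i. \<bar>B $ i $ i\<bar>" M] by simp
  then show ?thesis unfolding trace_def by (rule order_trans[OF sum_abs])
qed

text \<open>
  Along \<open>\<lambda> = \<lambda>2\<close> Abel's formula \<open>w1' = trace A \<cdot> w1\<close> holds, and a solution of a scalar linear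
  equation with one zero is identically zero.
\<close>

lemma omega1_along_l2_zero_everywhere:
  fixes G :: "real \<Rightarrow> real \<Rightarrow> real^'m^('m::finite + 'k::finite)"
  assumes A: "assumption_A A l1 l2" and G: "solves_ode A l1 l2 G" and H: "solves_ode A l1 l2 H"
    and l2: "l2 \<in> {l1..l2}"
    and x0: "x0 \<in> {0..1}" "omega_along omega1 (F_frame G H l2) x0 l2 = 0" and x: "x \<in> {0..1}"
  shows "omega_along omega1 (F_frame G H l2) x l2 = 0"
proof -
  let ?w = "\<lambda>x. omega_along omega1 (F_frame G H l2) x l2"
  obtain M where M: "0 \<le> M" "\<And>x l v. \<lbrakk>x \<in> {0..1}; l \<in> {l1..l2}\<rbrakk> \<Longrightarrow> norm (A x l *v v) \<le> M * norm v"
    using assumption_A_bounds[OF A] by blast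
  have D: "(?w has_vector_derivative trace (A x l2) * ?w x) (at x within {0..1})" if "x \<in> {0..1}" for x
    using omega1_along_has_derivative[OF G H l2 l2 that]
    unfolding has_real_derivative_iff_has_vector_derivative
    by (simp add: omega_along_def omega2_of_block_diag)
  have le: "norm (trace (A x l2) * ?w x) \<le> (CARD('m + 'k) * M) * norm (?w x)" if "x \<in> {0..1}" for x
    unfolding real_norm_def abs_mult
    by (rule mult_right_mono[OF abs_trace_le[OF M(2)[OF that l2]] abs_ge_zero])
  show ?thesis by (rule linear_growth_zero_everywhere[OF D le x0 x])
qed

text \<open>
  With \<open>B = A(x, \<lambda>2) - A_tilde(\<lambda>2)\<close>, the assumption says that also \<open>A(x, \<lambda>1) = A_tilde(\<lambda>1) + B\<close>.
  So the generator of the frame is \<open>AA_tilde + block_diag B B\<close>; the first summand produces \<open>\<omega>2\<close>,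
  and the second one the trace term.
\<close>

lemma omega1_along_derivative_assumption_B:
  assumes B: "assumption_B A l1 l2" and "l1 \<le> l2"
    and G: "solves_ode A l1 l2 G" and H: "solves_ode A l1 l2 H" and x: "x \<in> {0..1}"
  shows "((\<lambda>x. omega_along omega1 (F_frame G H l2) x l1) has_real_derivative
      omega_along (omega2_of (AA_tilde A l1 l2)) (F_frame G H l2) x l1
      + trace (A x l2 - A_tilde A l2) * omega_along omega1 (F_frame G H l2) x l1) (at x within {0..1})"
proof -
  let ?B = "A x l2 - A_tilde A l2"
  have l: "l1 \<in> {l1..l2}" "l2 \<in> {l1..l2}" and zero: "0 \<in> {0..1::real}" using \<open>l1 \<le> l2\<close> by auto
  have "A x l1 $ i $ j = A_tilde A l1 $ i $ j + ?B $ i $ j" for i j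
  proof (cases "i = j")
    case True
    then have "A x l1 $ i $ j = A x l2 $ i $ j" using B x l unfolding assumption_B_def by blast
    then show ?thesis using True by (simp add: A_tilde_def)
  next
    case False
    then have "A x l1 $ i $ j - A x l2 $ i $ j = A 0 l1 $ i $ j - A 0 l2 $ i $ j"
      using B x l zero unfolding assumption_B_def by blast
    then show ?thesis using False by (simp add: A_tilde_def)
  qed
  then have "block_diag (A x l1) (A x l2) = AA_tilde A l1 l2 + block_diag ?B ?B"
    by (auto simp: vec_eq_iff block_diag_def AA_tilde_def vcat_def hcat_def split: sum.splits)
  then show ?thesis
    using omega1_along_has_derivative[OF G H l x]
    by (simp add: omega_along_def omega2_of_add omega2_of_block_diag)
qed

section \<open>Indices along the sides of the rectangle\<close>

lemma frontier_rectangle: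
  fixes x l l1 l2 :: real
  assumes "x \<in> {0..1}" "l \<in> {l1..l2}" "x = 0 \<or> x = 1 \<or> l = l1 \<or> l = l2"
  shows "(x, l) \<in> frontier ({0..1} \<times> {l1..l2})"
  using assms by (auto simp: frontier_def closure_Times interior_Times)

lemma invariant_on_boundaryD:
  assumes "invariant_on_boundary F \<omega>1 \<omega>2 l1 l2"
    and "x \<in> {0..1}" "l \<in> {l1..l2}" "x = 0 \<or> x = 1 \<or> l = l1 \<or> l = l2"
  shows "(omega_along \<omega>1 F x l, omega_along \<omega>2 F x l) \<noteq> (0, 0)"
  using assms(1) frontier_rectangle[OF assms(2-4)] unfolding invariant_on_boundary_def by auto

lemma Ind_lambda_at_0:
  assumes inv: "invariant_on_boundary (F_frame G H l2) \<omega>1 \<omega>2 l1 l2"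
    and "l1 \<le> l2" and G: "\<forall>l\<in>{l1..l2}. G 0 l = P"
  shows "Ind_lambda (F_frame G H l2) \<omega>1 \<omega>2 l1 l2 0 = 0"
proof -
  have "omega_along \<omega> (F_frame G H l2) 0 l = omega_along \<omega> (F_frame G H l2) 0 l1"
    if "l \<in> {l1..l2}" for l \<omega>
    using G that \<open>l1 \<le> l2\<close> by (simp add: omega_along_def F_frame_def)
  moreover have "(omega_along \<omega>1 (F_frame G H l2) 0 l1, omega_along \<omega>2 (F_frame G H l2) 0 l1) \<noteq> (0, 0)"
    using \<open>l1 \<le> l2\<close> by (intro invariant_on_boundaryD[OF inv]) auto
  ultimately show ?thesis
    unfolding Ind_lambda_def by (intro maslov_ind_constant_path \<open>l1 \<le> l2\<close>)
qed

lemma Ind_x_at_l2: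
  assumes A: "assumption_A A l1 l2" and G: "solves_ode A l1 l2 G" and H: "solves_ode A l1 l2 H"
    and "l1 \<le> l2" and \<omega>2: "multilinear \<omega>2"
    and inv: "invariant_on_boundary (F_frame G H l2) omega1 \<omega>2 l1 l2"
  shows "Ind_x (F_frame G H l2) omega1 \<omega>2 l2 = 0"
proof -
  let ?w1 = "\<lambda>x. omega_along omega1 (F_frame G H l2) x l2"
  let ?w2 = "\<lambda>x. omega_along \<omega>2 (F_frame G H l2) x l2"
  have l2: "l2 \<in> {l1..l2}" using \<open>l1 \<le> l2\<close> by simp
  have cont: "continuous_on {0..1} (\<lambda>x. omega_along \<omega> (F_frame G H l2) x l2)" if "multilinear \<omega>" for \<omega>
    using that continuous_on_column_F_frame_x[OF G H l2 l2] by (rule continuous_on_omega_along_x)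
  obtain \<theta> where \<theta>: "polar_lift 0 1 ?w1 ?w2 \<theta>"
    using polar_lift_exists[OF cont[OF multilinear_omega1] cont[OF \<omega>2]] invariant_on_boundaryD[OF inv _ l2]
    by blast
  show ?thesis
  proof (cases "\<exists>x0\<in>{0..1}. ?w1 x0 = 0")
    case True
    then have "?w1 x = 0" if "x \<in> {0..1}" for x
      using omega1_along_l2_zero_everywhere[OF A G H l2] that by blast
    then show ?thesis unfolding Ind_x_def by (intro maslov_ind_eq_0_if_constantly_zero[OF _ \<theta>]) auto
  next
    case False
    then have "{x \<in> {0..1}. ?w1 x = 0} = {}" by blast
    then show ?thesis
      unfolding Ind_x_def using abs_maslov_ind_le_card_zeros[OF zero_le_one \<theta>] by (simp only:) simp
  qed
qed

lemma num_eigenvalues_ge_Ind_lambda: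
  assumes A: "assumption_A A l1 l2" and G: "solves_ode A l1 l2 G" and "l1 \<le> l2"
    and P: "\<forall>l\<in>{l1..l2}. G 0 l = P" "is_frame P p" and Q: "is_frame (H 1 l2) q"
    and \<omega>2: "multilinear \<omega>2"
    and inv: "invariant_on_boundary (F_frame G H l2) omega1 \<omega>2 l1 l2"
  shows "num_eigenvalues A p q l1 l2 \<ge> enat (nat \<bar>Ind_lambda (F_frame G H l2) omega1 \<omega>2 l1 l2 1\<bar>)"
proof (cases "finite {l \<in> {l1..l2}. is_eigenvalue A p q l}")
  case True
  let ?w1 = "\<lambda>l. omega_along omega1 (F_frame G H l2) 1 l"
  let ?w2 = "\<lambda>l. omega_along \<omega>2 (F_frame G H l2) 1 l"
  let ?E = "{l \<in> {l1..l2}. is_eigenvalue A p q l}" and ?Z = "{l \<in> {l1..l2}. ?w1 l = 0}"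
  have "continuous_on {l1..l2} (\<lambda>l. omega_along \<omega> (F_frame G H l2) 1 l)" if "multilinear \<omega>" for \<omega>
    unfolding omega_along_def
    using that continuous_on_column_F_frame_lambda[OF A G P(1)] by (rule continuous_on_multilinear)
  then obtain \<theta> where \<theta>: "polar_lift l1 l2 ?w1 ?w2 \<theta>"
    using polar_lift_exists[of l1 l2 ?w1 ?w2] multilinear_omega1 \<omega>2 invariant_on_boundaryD[OF inv, of 1]
    by auto
  have "?Z \<subseteq> ?E"
    using is_eigenvalue_if_omega1_eq_0[OF A G, where p = p and q = q] P Q by auto
  then have "finite ?Z" "card ?Z \<le> card ?E" using True by (auto intro: finite_subset card_mono)
  then show ?thesis
    using abs_maslov_ind_le_card_zeros[OF \<open>l1 \<le> l2\<close> \<theta>] True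
    by (simp add: num_eigenvalues_def Ind_lambda_def)
next
  case False
  then show ?thesis by (simp add: num_eigenvalues_def)
qed

lemma Ind_x_eq_card_intersections:
  assumes A: "assumption_A A l1 l2" and B: "assumption_B A l1 l2"
    and G: "solves_ode A l1 l2 G" and H: "solves_ode A l1 l2 H" and "l1 \<le> l2"
    and P: "is_frame (G 0 l1) p" and Q: "is_frame (H 1 l2) q"
    and inv: "invariant_on_boundary (F_frame G H l2) omega1 (omega2_of (AA_tilde A l1 l2)) l1 l2"
  defines "X \<equiv> {x \<in> {0<..1}. col_space (G x l1) \<inter> col_space (H x l2) \<noteq> {0}}"
  shows "finite X"
    and "Ind_x (F_frame G H l2) omega1 (omega2_of (AA_tilde A l1 l2)) l1 = int (card X)"
proof -
  let ?w1 = "\<lambda>x. omega_along omega1 (F_frame G H l2) x l1"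
  let ?w2 = "\<lambda>x. omega_along (omega2_of (AA_tilde A l1 l2)) (F_frame G H l2) x l1"
  have l: "l1 \<in> {l1..l2}" "l2 \<in> {l1..l2}" using \<open>l1 \<le> l2\<close> by auto
  have c1: "continuous_on {0..1} ?w1"
    using multilinear_omega1 continuous_on_column_F_frame_x[OF G H l] by (rule continuous_on_omega_along_x)
  have c2: "continuous_on {0..1} ?w2"
    using continuous_on_column_F_frame_x[OF G H l] by (rule continuous_on_omega2_of)
  note nz = invariant_on_boundaryD[OF inv _ l(1)]
  obtain \<theta> where \<theta>: "polar_lift 0 1 ?w1 ?w2 \<theta>"
    using polar_lift_exists[OF c1 c2] nz by blast
  have "\<exists>D. (?w1 has_real_derivative D) (at x within {0..1}) \<and> D * ?w2 x > 0"
    if x: "x \<in> {0..1}" and zero: "?w1 x = 0" for x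
  proof (intro exI conjI)
    show "(?w1 has_real_derivative ?w2 x) (at x within {0..1})"
      using omega1_along_derivative_assumption_B[OF B \<open>l1 \<le> l2\<close> G H x] zero by simp
    have "?w2 x \<noteq> 0" using nz[OF x] zero by auto
    then show "?w2 x * ?w2 x > 0" by (metis not_real_square_gt_zero)
  qed
  note count = maslov_ind_eq_card_zeros[OF zero_le_one \<theta> this]
  have "?w1 x = 0 \<longleftrightarrow> col_space (G x l1) \<inter> col_space (H x l2) \<noteq> {0}" if "x \<in> {0<..1}" for x
  proof (rule omega_along_omega1_eq_0_iff_intersect)
    have x: "x \<in> {0..1}" using that by simp
    show "c = 0" if "G x l1 *v c = 0" for c
      using solution_frame_mult_eq_0[OF A G l(1) _ P x that] by simp
    show "d = 0" if "H x l2 *v d = 0" for d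
      using solution_frame_mult_eq_0[OF A H l(2) _ Q x that] by simp
  qed
  then have "X = {x \<in> {0<..1}. ?w1 x = 0}" unfolding X_def by blast
  then show "finite X" "Ind_x (F_frame G H l2) omega1 (omega2_of (AA_tilde A l1 l2)) l1 = int (card X)"
    using count by (simp_all add: Ind_x_def)
qed

theorem theorem1p1:
  fixes A :: "real \<Rightarrow> real \<Rightarrow> real^('m::finite + 'k::finite)^('m + 'k)"
    and l1 l2 :: real
    and p q :: "(real^('m + 'k)) set"
    and P :: "real^'m^('m + 'k)" and Q :: "real^'k^('m + 'k)"
    and G :: "real \<Rightarrow> real \<Rightarrow> real^'m^('m + 'k)"
    and H :: "real \<Rightarrow> real \<Rightarrow> real^'k^('m + 'k)"
  assumes "l1 < l2" and "assumption_A A l1 l2"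
    and "subspace p" and "dim p = CARD('m)"
    and "subspace q" and "dim q = CARD('k)"
    and "is_frame P p" and "is_frame Q q"
    and "solves_ode A l1 l2 G" and "\<forall>l\<in>{l1..l2}. G 0 l = P"
    and "solves_ode A l1 l2 H" and "\<forall>l\<in>{l1..l2}. H 1 l = Q"
  shows
    "(\<forall>\<omega>2 :: ('m + 'k \<Rightarrow> real^(('m + 'k) + ('m + 'k))) \<Rightarrow> real.
        multilinear \<omega>2 \<longrightarrow> skew_symmetric \<omega>2 \<longrightarrow>
        invariant_on_boundary (F_frame G H l2) omega1 \<omega>2 l1 l2 \<longrightarrow>
        num_eigenvalues A p q l1 l2 \<ge>
          enat (nat \<bar>Ind_x (F_frame G H l2) omega1 \<omega>2 l1
                     + boundary_index (F_frame G H l2) omega1 \<omega>2 l1 l2\<bar>))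
     \<and>
     (assumption_B A l1 l2 \<longrightarrow>
        (let \<omega>2 = omega2_of (AA_tilde A l1 l2);
             X = {x\<in>{0<..1}. col_space (G x l1) \<inter> col_space (H x l2) \<noteq> {0}}
         in invariant_on_boundary (F_frame G H l2) omega1 \<omega>2 l1 l2 \<longrightarrow>
            finite X \<and> Ind_x (F_frame G H l2) omega1 \<omega>2 l1 = int (card X)))"
proof (intro conjI allI impI)
  have l: "l1 \<le> l2" "l1 \<in> {l1..l2}" "l2 \<in> {l1..l2}" using assms(1) by auto
  have P: "is_frame (G 0 l1) p" and Q: "is_frame (H 1 l2) q" using assms l by auto
  show "num_eigenvalues A p q l1 l2 \<ge>
      enat (nat \<bar>Ind_x (F_frame G H l2) omega1 \<omega>2 l1
                 + boundary_index (F_frame G H l2) omega1 \<omega>2 l1 l2\<bar>)"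
    if \<omega>2: "multilinear \<omega>2" and inv: "invariant_on_boundary (F_frame G H l2) omega1 \<omega>2 l1 l2" for \<omega>2
  proof -
    \<comment> \<open>The index along \<open>\<lambda> = \<lambda>1\<close> cancels, and the sides \<open>x = 0\<close> and \<open>\<lambda> = \<lambda>2\<close> contribute \<open>0\<close>.\<close>
    have "Ind_x (F_frame G H l2) omega1 \<omega>2 l1 + boundary_index (F_frame G H l2) omega1 \<omega>2 l1 l2
        = - Ind_lambda (F_frame G H l2) omega1 \<omega>2 l1 l2 1"
      unfolding boundary_index_def
      using Ind_lambda_at_0[OF inv l(1) assms(10)] Ind_x_at_l2[OF assms(2,9,11) l(1) \<omega>2 inv] by simp
    then show ?thesis
      using num_eigenvalues_ge_Ind_lambda[OF assms(2,9) l(1) assms(10,7) Q \<omega>2 inv]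
      by (simp only: abs_minus_cancel)
  qed
  show "let \<omega>2 = omega2_of (AA_tilde A l1 l2);
             X = {x\<in>{0<..1}. col_space (G x l1) \<inter> col_space (H x l2) \<noteq> {0}}
         in invariant_on_boundary (F_frame G H l2) omega1 \<omega>2 l1 l2 \<longrightarrow>
            finite X \<and> Ind_x (F_frame G H l2) omega1 \<omega>2 l1 = int (card X)"
    if "assumption_B A l1 l2"
    unfolding Let_def
    using Ind_x_eq_card_intersections[OF assms(2) that assms(9,11) l(1) P Q] by blast
qed

end
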